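(* For every lattice-face $d$-polytope $P\subset\mathbb R^d$ ($d\ge1$), $|\mathcal L(\Omega(P))|=\mathrm{Vol}(P)$.
   Context: For $k\ge1$, $\pi:\mathbb R^k\to\mathbb R^{k-1}$ forgets the last coordinate ($\mathbb R^0$ is a point). For a compact set $S\subset\mathbb R^k$ and $y\in\pi(S)$, let $n(y,S)$ be the point of $S\cap\pi^{-1}(y)$ with smallest last coordinate; the negative boundary is $NB(S)=\{n(y,S):y\in\pi(S)\}$ and the nonnegative part is $\Omega(S)=S\setminus NB(S)$. $\mathcal L(S)=S\cap\mathbb Z^k$. $\mathrm{Vol}$ is $d$-dimensional volume. Lattice-face polytopes are defined recursively: a segment in $\mathbb R$ is lattice-face if its endpoints are integers. For $d\ge2$, a $d$-polytope $P\subset\mathbb R^d$ with vertex set $V$ is lattice-face if for every $d$-element subset $U\subset V$: (a) $\pi(\mathrm{conv}(U))$ is a lattice-face polytope in $\mathbb R^{d-1}$, and (b) $\pi(H_U\cap\mathbb Z^d)=\mathbb Z^{d-1}$, where $H_U$ is the affine span of $U$. *)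

theory Defs
  imports "HOL-Analysis.Analysis" "HOL-Library.Function_Algebras"
begin

text \<open>Points of R^k are represented as functions nat => real vanishing outside
  the index range 0..k-1 (coordinate i is x i).  Since the dimension varies
  in the recursive definition of lattice-face polytopes, we use one ambient
  type and equip it with the pointwise real vector space structure so that the
  library notions convex hull, affine hull, extreme points and polytopes apply.\<close>

instantiation "fun" :: (type, real_vector) real_vector
begin
definition scaleR_fun :: "real \<Rightarrow> ('a \<Rightarrow> 'b) \<Rightarrow> 'a \<Rightarrow> 'b"
  where "scaleR_fun r f = (\<lambda>x. r *\<^sub>R f x)"
instance
  by standard (auto simp: scaleR_fun_def fun_eq_iff scaleR_add_right scaleR_add_left)
end

definition Rk :: "nat \<Rightarrow> (nat \<Rightarrow> real) set"
  where "Rk k = {x. \<forall>i\<ge>k. x i = 0}"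

definition Zk :: "nat \<Rightarrow> (nat \<Rightarrow> real) set"
  where "Zk k = {x. (\<forall>i<k. x i \<in> \<int>) \<and> (\<forall>i\<ge>k. x i = 0)}"

definition proj :: "nat \<Rightarrow> (nat \<Rightarrow> real) \<Rightarrow> (nat \<Rightarrow> real)"
  where "proj k x = x(k - 1 := 0)"

definition NB :: "nat \<Rightarrow> (nat \<Rightarrow> real) set \<Rightarrow> (nat \<Rightarrow> real) set"
  where "NB k S = {x \<in> S. \<forall>z\<in>S. proj k z = proj k x \<longrightarrow> x (k - 1) \<le> z (k - 1)}"

definition Omega :: "nat \<Rightarrow> (nat \<Rightarrow> real) set \<Rightarrow> (nat \<Rightarrow> real) set"
  where "Omega k S = S - NB k S"

definition Lat :: "nat \<Rightarrow> (nat \<Rightarrow> real) set \<Rightarrow> (nat \<Rightarrow> real) set"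
  where "Lat k S = S \<inter> Zk k"

definition Vol :: "nat \<Rightarrow> (nat \<Rightarrow> real) set \<Rightarrow> real"
  where "Vol d S = measure (PiM {..<d} (\<lambda>_. lborel)) ((\<lambda>x. restrict x {..<d}) ` S)"

definition d_polytope :: "nat \<Rightarrow> (nat \<Rightarrow> real) set \<Rightarrow> bool"
  where "d_polytope d P \<longleftrightarrow> polytope P \<and> P \<subseteq> Rk d \<and> affine hull P = Rk d"

definition vertices :: "(nat \<Rightarrow> real) set \<Rightarrow> (nat \<Rightarrow> real) set"
  where "vertices P = {v. v extreme_point_of P}"

fun lattice_face :: "nat \<Rightarrow> (nat \<Rightarrow> real) set \<Rightarrow> bool" where
  "lattice_face 0 P = False"
| "lattice_face (Suc 0) P =
     (\<exists>p q. p \<in> Zk 1 \<and> q \<in> Zk 1 \<and> p \<noteq> q \<and> P = closed_segment p q)"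
| "lattice_face (Suc (Suc k)) P =
     (d_polytope (Suc (Suc k)) P \<and>
      (\<forall>U. U \<subseteq> vertices P \<and> card U = Suc (Suc k) \<longrightarrow>
          lattice_face (Suc k) (proj (Suc (Suc k)) ` (convex hull U)) \<and>
          proj (Suc (Suc k)) ` (affine hull U \<inter> Zk (Suc (Suc k))) = Zk (Suc k)))"

end

theory Submission
  imports Defs
begin

text \<open>
  For a polytope \<open>P\<close> whose vertices \<open>V\<close> satisfy the lattice-face conditions, the fibre of \<open>P\<close>
  over a lattice point of \<open>\<real>\<^sup>d\<^sup>-\<^sup>1\<close> is a segment with integer endpoints, so the count
  is the sum of the fibre lengths over \<open>\<int>\<^sup>d\<^sup>-\<^sup>1\<close>. The lengths are additive over a triangulation of
  \<open>P\<close> with vertices in \<open>V\<close>, because every hyperplane through \<open>d\<close> vertices is a graph over the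
  first \<open>d - 1\<close> coordinates. It remains to replace, for a simplex, the sums by integrals one
  coordinate at a time.

  Fix integers \<open>y\<^sub>0, \<dots>, y\<^sub>k\<^sub>-\<^sub>1\<close>, let \<open>G t\<close> be the volume of the section of the simplex where the
  first \<open>k + 1\<close> coordinates are \<open>y, t\<close>, and let \<open>E \<sigma>\<close> be the sum of \<open>G (t + \<sigma>)\<close> over all
  integers \<open>t\<close>. The derivative of \<open>G\<close> is a linear combination of the same functions for the
  projected facets, so by induction on the dimension \<open>E\<close> has constant derivative on \<open>(0, 1)\<close>;
  as \<open>E\<close> is continuous with \<open>E 0 = E 1\<close>, it is constant, and \<open>E 0\<close> equals its mean, the
  integral of \<open>G\<close>. The induction starts with indicators of segments with integer endpoints,
  for which \<open>E\<close> is constant on the open interval only.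
\<close>

section \<open>Simplices in barycentric form\<close>

text \<open>Lattice points of closed simplices are not additive over a triangulation, since shared
  faces would be counted twice. Fibre lengths are additive, because shared faces meet a vertical
  line in finitely many points; hence the count is turned into lengths before P is cut up. The open
  interval at the start of the induction has a similar cause: a segment from a to b with integer
  ends meets the shifted integers \<open>t + \<sigma>\<close> in b - a points when 0 <
  \<open>\<sigma>\<close> < 1, but in b - a + 1 points when \<open>\<sigma>\<close> = 0. A single
  integration removes this defect, so sums become integrals only in coordinates below the last one;
  in the last coordinate, deleting the negative boundary removes the extra point. The induction
  closes up because deleting a vertex of a simplex and projecting the opposite facet gives a simplex
  of the same kind. Cells ignore all coordinates beyond their dimension, so facets, projections and
  partial integrals live on one type of points.\<close>

text \<open>An affine functional is stored as its constant term and its coefficients; the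
  dimension, i.e. the number of coordinates used, is supplied on evaluation.\<close>

type_synonym point = "nat \<Rightarrow> real"
type_synonym aff_fun = "real \<times> (nat \<Rightarrow> real)"

definition aff_val :: "nat \<Rightarrow> aff_fun \<Rightarrow> point \<Rightarrow> real"
  where "aff_val d g x = fst g + (\<Sum>i<d. snd g i * x i)"

text \<open>The recursion in the definition of lattice-face polytopes, unrolled: \<open>j + 1\<close> vertices
  project to an affinely independent set in the first \<open>j\<close> coordinates, and the \<open>j\<close>-th
  coordinate is an integer-valued affine function of these on their span.\<close>

definition lattice_general :: "nat \<Rightarrow> point set \<Rightarrow> bool"
  where "lattice_general d V \<longleftrightarrow> (\<forall>j<d. \<forall>W\<subseteq>V. card W = Suc j \<longrightarrow>
    (\<forall>c. (\<Sum>w\<in>W. c w) = 0 \<and> (\<forall>i<j. (\<Sum>w\<in>W. c w * w i) = 0) \<longrightarrow> (\<forall>w\<in>W. c w = 0)) \<and>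
    (\<forall>c. (\<Sum>w\<in>W. c w) = 1 \<and> (\<forall>i<j. (\<Sum>w\<in>W. c w * w i) \<in> \<int>) \<longrightarrow> (\<Sum>w\<in>W. c w * w j) \<in> \<int>))"

definition barycentric :: "nat \<Rightarrow> (point \<Rightarrow> aff_fun) \<Rightarrow> point set \<Rightarrow> bool"
  where "barycentric d f S \<longleftrightarrow>
    (\<forall>x. (\<Sum>s\<in>S. aff_val d (f s) x) = 1 \<and> (\<forall>i<d. (\<Sum>s\<in>S. aff_val d (f s) x * s i) = x i))"

definition lattice_simplex :: "nat \<Rightarrow> (point \<Rightarrow> aff_fun) \<Rightarrow> point set \<Rightarrow> bool"
  where "lattice_simplex d f S \<longleftrightarrow> card S = Suc d \<and> barycentric d f S \<and> lattice_general d S"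

definition cell :: "nat \<Rightarrow> (point \<Rightarrow> aff_fun) \<Rightarrow> point set \<Rightarrow> point set"
  where "cell d f S = {x. \<forall>s\<in>S. 0 \<le> aff_val d (f s) x}"

text \<open>Solves g = 0 for coordinate d, so that the hyperplane becomes a graph over the first d
  coordinates. Here g has dimension d + 1, and \<open>aff_val d\<close> cuts off its last
  term.\<close>

definition height :: "nat \<Rightarrow> aff_fun \<Rightarrow> point \<Rightarrow> real"
  where "height d g x = - aff_val d g x / snd g d"

text \<open>Eliminating coordinate \<open>d\<close> by means of the functional of \<open>s\<close> turns barycentric coordinates
  of a simplex into those of the projection of the facet opposite to \<open>s\<close>.\<close>

definition facet_family ::
    "nat \<Rightarrow> point \<Rightarrow> (point \<Rightarrow> aff_fun) \<Rightarrow> point \<Rightarrow> aff_fun"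
  where "facet_family d s f s' = (let q = snd (f s') d / snd (f s) d in
    (fst (f s') - q * fst (f s), \<lambda>i. snd (f s') i - q * snd (f s) i))"

section \<open>Evaluation of affine functionals and elimination of a coordinate\<close>

lemma aff_val_Suc: "aff_val (Suc d) g x = aff_val d g x + snd g d * x d"
  by (simp add: aff_val_def)

lemma aff_val_upd_ge: "d \<le> j \<Longrightarrow> aff_val d g (x(j := t)) = aff_val d g x"
  unfolding aff_val_def by (intro arg_cong2[where f="(+)"] refl sum.cong) auto

lemma aff_val_upd_less:
  assumes "j < d"
  shows "aff_val d g (x(j := t)) = aff_val d g x + snd g j * (t - x j)"
proof -
  have "(\<Sum>i<d. snd g i * (x(j := t)) i) = (\<Sum>i<d. snd g i * x i + (if i = j then snd g j * (t - x j) else 0))"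
    by (intro sum.cong) (auto simp: algebra_simps)
  also have "\<dots> = (\<Sum>i<d. snd g i * x i) + snd g j * (t - x j)"
    using assms by (simp add: sum.distrib)
  finally show ?thesis by (simp add: aff_val_def)
qed

lemma aff_val_height:
  "snd g d \<noteq> 0 \<Longrightarrow> aff_val (Suc d) g x = snd g d * (x d - height d g x)"
  by (simp add: aff_val_Suc height_def field_simps)

lemma aff_val_facet_family:
  assumes "snd (f s) d \<noteq> 0"
  shows "aff_val d (facet_family d s f s') x = aff_val (Suc d) (f s') (x(d := height d (f s) x))"
proof -
  have "aff_val (Suc d) (f s') (x(d := height d (f s) x))
      = aff_val d (f s') x - snd (f s') d / snd (f s) d * aff_val d (f s) x"
    by (simp add: aff_val_Suc aff_val_upd_ge height_def)
  also have "\<dots> = aff_val d (facet_family d s f s') x"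
    by (simp add: aff_val_def facet_family_def Let_def sum_subtractf sum_distrib_left algebra_simps)
  finally show ?thesis by simp
qed

text \<open>Turns membership in a projected facet into a comparison of heights: the facet of s is
  feasible over x when its graph lies on the right side of all the other graphs.\<close>

lemma facet_family_height_diff:
  assumes "snd (f s) d \<noteq> 0" "snd (f s') d \<noteq> 0"
  shows "aff_val d (facet_family d s f s') x = snd (f s') d * (height d (f s) x - height d (f s') x)"
  using assms by (simp add: aff_val_facet_family aff_val_height) (simp add: height_def aff_val_upd_ge)

section \<open>Slopes, heights and facets of lattice simplices\<close>

lemma lattice_general_mono:
  "lattice_general d V \<Longrightarrow> d' \<le> d \<Longrightarrow> W \<subseteq> V \<Longrightarrow> lattice_general d' W"
  unfolding lattice_general_def by (meson order_less_le_trans subset_trans)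

lemma lattice_generalD_indep:
  assumes "lattice_general d V" "j < d" "W \<subseteq> V" "card W = Suc j"
    "(\<Sum>w\<in>W. c w) = 0" "\<And>i. i < j \<Longrightarrow> (\<Sum>w\<in>W. c w * w i) = 0" "w \<in> W"
  shows "c w = 0"
  using assms unfolding lattice_general_def by blast

lemma lattice_generalD_int:
  assumes "lattice_general d V" "j < d" "W \<subseteq> V" "card W = Suc j"
    "(\<Sum>w\<in>W. c w) = 1" "\<And>i. i < j \<Longrightarrow> (\<Sum>w\<in>W. c w * w i) \<in> \<int>"
  shows "(\<Sum>w\<in>W. c w * w j) \<in> \<int>"
  using assms unfolding lattice_general_def by blast

lemma lattice_simplex_finite: "lattice_simplex d f S \<Longrightarrow> finite S"
  by (simp add: lattice_simplex_def card_ge_0_finite)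

lemma barycentric_sum: "barycentric d f S \<Longrightarrow> (\<Sum>s\<in>S. aff_val d (f s) x) = 1"
  and barycentric_coord: "barycentric d f S \<Longrightarrow> i < d \<Longrightarrow> (\<Sum>s\<in>S. aff_val d (f s) x * s i) = x i"
  by (auto simp: barycentric_def)

text \<open>Compares the coefficients of coordinate d in the barycentric identities, as the
  difference of their values at a unit vector and at the origin.\<close>

lemma barycentric_slope_sum:
  assumes "barycentric (Suc d) f S"
  shows "(\<Sum>s\<in>S. snd (f s) d) = 0"
    and "i \<le> d \<Longrightarrow> (\<Sum>s\<in>S. snd (f s) d * s i) = (if i = d then 1 else 0)"
proof -
  let ?x = "\<lambda>i. 0::real"
  have *: "snd (f s) d = aff_val (Suc d) (f s) (?x(d := 1)) - aff_val (Suc d) (f s) ?x" for s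
    by (simp add: aff_val_upd_less)
  show "(\<Sum>s\<in>S. snd (f s) d) = 0"
    by (simp only: * sum_subtractf barycentric_sum[OF assms])
  show "i \<le> d \<Longrightarrow> (\<Sum>s\<in>S. snd (f s) d * s i) = (if i = d then 1 else 0)"
    by (simp add: * left_diff_distrib sum_subtractf barycentric_coord[OF assms])
qed

text \<open>No facet is vertical. Otherwise the other slopes form an affine relation among the d + 1
  points \<open>S - {s}\<close> in the first d coordinates, so they all vanish, although their sum
  weighted by coordinate d is 1.\<close>

lemma lattice_simplex_slope:
  assumes S: "lattice_simplex (Suc d) f S" and s: "s \<in> S"
  shows "snd (f s) d \<noteq> 0"
proof
  assume 0: "snd (f s) d = 0"
  have bary: "barycentric (Suc d) f S" and fin: "finite S"
    using S lattice_simplex_finite by (auto simp: lattice_simplex_def)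
  have drop: "(\<Sum>u\<in>S. snd (f u) d * h u) = (\<Sum>u\<in>S - {s}. snd (f u) d * h u)" for h
    using 0 by (simp add: sum.remove[OF fin s])
  have "snd (f u) d = 0" if "u \<in> S - {s}" for u
  proof (rule lattice_generalD_indep[where W="S - {s}" and j=d and V=S and d="Suc d" and c="\<lambda>u. snd (f u) d"])
    show "(\<Sum>w\<in>S - {s}. snd (f w) d) = 0"
      using barycentric_slope_sum(1)[OF bary] drop[of "\<lambda>_. 1"] by simp
    show "(\<Sum>w\<in>S - {s}. snd (f w) d * w i) = 0" if "i < d" for i
      using barycentric_slope_sum(2)[OF bary, of i] drop[of "\<lambda>w. w i"] that by simp
  qed (use S s fin that in \<open>auto simp: lattice_simplex_def\<close>)
  then have "(\<Sum>u\<in>S. snd (f u) d * u d) = 0"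
    unfolding drop by simp
  then show False
    using barycentric_slope_sum(2)[OF bary, of d] by simp
qed

text \<open>The point above x on the hyperplane of the facet has weight 0 at s. It is thus an affine
  combination of the other d + 1 vertices with integers in the first d coordinates, and the lattice
  condition yields the last one.\<close>

lemma lattice_simplex_height_int:
  assumes S: "lattice_simplex (Suc d) f S" and s: "s \<in> S" and x: "\<And>i. i < d \<Longrightarrow> x i \<in> \<int>"
  shows "height d (f s) x \<in> \<int>"
proof -
  have bary: "barycentric (Suc d) f S" and fin: "finite S"
    using S lattice_simplex_finite by (auto simp: lattice_simplex_def)
  let ?x = "x(d := height d (f s) x)"
  have "aff_val (Suc d) (f s) ?x = 0"
    using lattice_simplex_slope[OF S s] by (simp add: aff_val_height) (simp add: height_def aff_val_upd_ge)
  then have drop: "(\<Sum>u\<in>S. aff_val (Suc d) (f u) ?x * h u) = (\<Sum>u\<in>S - {s}. aff_val (Suc d) (f u) ?x * h u)" for h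
    by (simp add: sum.remove[OF fin s])
  have "(\<Sum>w\<in>S - {s}. aff_val (Suc d) (f w) ?x * w d) \<in> \<int>"
  proof (rule lattice_generalD_int[where V=S and d="Suc d"])
    show "(\<Sum>w\<in>S - {s}. aff_val (Suc d) (f w) ?x) = 1"
      using barycentric_sum[OF bary, of ?x] drop[of "\<lambda>_. 1"] by simp
    show "(\<Sum>w\<in>S - {s}. aff_val (Suc d) (f w) ?x * w i) \<in> \<int>" if "i < d" for i
      using barycentric_coord[OF bary, of i ?x] drop[of "\<lambda>w. w i"] that x by simp
  qed (use S s fin in \<open>auto simp: lattice_simplex_def\<close>)
  then show ?thesis
    using barycentric_coord[OF bary, of d ?x] drop[of "\<lambda>w. w d"] by simp
qed

text \<open>At the point of the facet hyperplane above x the weight of s vanishes, so the weights of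
  the other vertices already satisfy the barycentric identities in the first d coordinates.\<close>

lemma lattice_simplex_facet:
  assumes S: "lattice_simplex (Suc d) f S" and s: "s \<in> S"
  shows "lattice_simplex d (facet_family d s f) (S - {s})"
  unfolding lattice_simplex_def
proof (intro conjI)
  have bary: "barycentric (Suc d) f S" and fin: "finite S"
    using S lattice_simplex_finite by (auto simp: lattice_simplex_def)
  show "card (S - {s}) = Suc d"
    using S s fin by (simp add: lattice_simplex_def)
  show "lattice_general d (S - {s})"
    using S by (auto simp: lattice_simplex_def intro: lattice_general_mono)
  have nz: "snd (f s) d \<noteq> 0"
    using lattice_simplex_slope[OF S s] .
  have drop: "(\<Sum>u\<in>S - {s}. aff_val d (facet_family d s f u) x * h u)
      = (\<Sum>u\<in>S. aff_val (Suc d) (f u) (x(d := height d (f s) x)) * h u)" for h x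
    using nz by (simp add: sum.remove[OF fin s] aff_val_facet_family)
      (simp add: aff_val_height height_def aff_val_upd_ge)
  show "barycentric d (facet_family d s f) (S - {s})"
    unfolding barycentric_def
  proof (intro allI conjI impI)
    fix x
    show "(\<Sum>sa\<in>S - {s}. aff_val d (facet_family d s f sa) x) = 1"
      using drop[where h="\<lambda>_. 1" and x=x] barycentric_sum[OF bary] by simp
    show "(\<Sum>sa\<in>S - {s}. aff_val d (facet_family d s f sa) x * sa i) = x i" if "i < d" for i
      using drop[where h="\<lambda>w. w i" and x=x] barycentric_coord[OF bary, of i] that by simp
  qed
qed

lemma cell_bounded:
  assumes "barycentric d f S" "x \<in> cell d f S" "i < d" "\<And>s. s \<in> S \<Longrightarrow> \<bar>s i\<bar> \<le> B"
  shows "\<bar>x i\<bar> \<le> B"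
proof -
  have "\<bar>x i\<bar> = \<bar>\<Sum>s\<in>S. aff_val d (f s) x * s i\<bar>"
    using assms by (simp add: barycentric_coord)
  also have "\<dots> \<le> (\<Sum>s\<in>S. aff_val d (f s) x * B)"
    using assms by (intro order_trans[OF sum_abs] sum_mono)
      (auto simp: abs_mult cell_def intro!: mult_left_mono)
  also have "\<dots> = B"
    using barycentric_sum[OF assms(1)] by (simp flip: sum_distrib_right)
  finally show ?thesis .
qed

section \<open>Integration over a range of coordinates\<close>

abbreviation coord_space :: "point measure"
  where "coord_space \<equiv> PiM UNIV (\<lambda>_. borel)"

abbreviation leb :: "nat \<Rightarrow> nat \<Rightarrow> point measure"
  where "leb k m \<equiv> PiM {k..<m} (\<lambda>_. lborel)"

definition glue :: "nat \<Rightarrow> nat \<Rightarrow> point \<Rightarrow> point \<Rightarrow> nat \<Rightarrow> real"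
  where "glue k m x z = (\<lambda>i. if k \<le> i \<and> i < m then z i else x i)"

text \<open>The result is again a function of a whole point, so partial integrals can be nested and
  evaluated at updated points without changing types.\<close>

definition part_int :: "nat \<Rightarrow> nat \<Rightarrow> (point \<Rightarrow> real) \<Rightarrow> point \<Rightarrow> real"
  where "part_int k m g x = (\<integral>z. g (glue k m x z) \<partial>leb k m)"

text \<open>Support is bounded only in the first m coordinates, since cells are cylinders in the
  others. One constant bounds both values and support.\<close>

definition box_fun :: "nat \<Rightarrow> (point \<Rightarrow> real) \<Rightarrow> bool"
  where "box_fun m g \<longleftrightarrow> g \<in> borel_measurable coord_space \<and>
    (\<exists>B. \<forall>x. \<bar>g x\<bar> \<le> B \<and> (g x \<noteq> 0 \<longrightarrow> (\<forall>i<m. \<bar>x i\<bar> \<le> B)))"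

section \<open>Measurability and integrability of partial integrals\<close>

interpretation lborel_prod: product_sigma_finite "\<lambda>_::nat. lborel :: real measure"
  by standard

lemma sigma_finite_leb: "sigma_finite_measure (leb k m)"
  by (intro lborel_prod.sigma_finite) simp

lemma measurable_coord_spaceI:
  assumes "\<And>i. (\<lambda>w. X w i) \<in> borel_measurable M"
  shows "X \<in> measurable M coord_space"
  using assms by (intro measurable_PiM_single') (auto simp: space_PiM)

lemma measurable_coord [measurable]: "(\<lambda>x. x i) \<in> borel_measurable coord_space"
  by (rule measurable_component_singleton) simp

lemma measurable_glue:
  assumes X: "\<And>i. (\<lambda>w. X w i) \<in> borel_measurable M" and Z: "Z \<in> measurable M (leb k m)"
  shows "(\<lambda>w. glue k m (X w) (Z w)) \<in> measurable M coord_space"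
proof (rule measurable_coord_spaceI)
  fix i
  show "(\<lambda>w. glue k m (X w) (Z w) i) \<in> borel_measurable M"
  proof (cases "k \<le> i \<and> i < m")
    case True
    then have "(\<lambda>z. z i) \<in> measurable (leb k m) lborel"
      by (intro measurable_component_singleton) auto
    then have "(\<lambda>w. Z w i) \<in> measurable M lborel"
      using Z by (rule measurable_compose[rotated])
    then show ?thesis using True by (simp add: glue_def)
  next
    case False
    then show ?thesis using X by (auto simp: glue_def)
  qed
qed

lemma measurable_glue_const [measurable]: "glue k m x \<in> measurable (leb k m) coord_space"
  using measurable_glue[of "\<lambda>_. x" "leb k m" "\<lambda>z. z"] by simp

lemma borel_measurable_aff_val [measurable]: "aff_val d g \<in> borel_measurable coord_space"
proof -
  have "(\<lambda>x. fst g + (\<Sum>i<d. snd g i * x i)) \<in> borel_measurable coord_space"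
    by measurable
  then show ?thesis by (simp add: aff_val_def[abs_def])
qed

lemma box_funD_measurable: "box_fun m g \<Longrightarrow> g \<in> borel_measurable coord_space"
  by (simp add: box_fun_def)

lemma emeasure_leb_box: "emeasure (leb k m) (PiE {k..<m} (\<lambda>_. {-B..B})) < \<infinity>"
  by (subst lborel_prod.emeasure_PiM) (auto simp: power_eq_top_ennreal emeasure_lborel_Icc_eq less_top[symmetric])

lemma box_fun_glue_support:
  assumes "\<forall>x. \<bar>g x\<bar> \<le> B \<and> (g x \<noteq> 0 \<longrightarrow> (\<forall>i<m. \<bar>x i\<bar> \<le> B))" "z \<in> space (leb k m)" "g (glue k m x z) \<noteq> 0"
  shows "z \<in> PiE {k..<m} (\<lambda>_. {-B..B})"
proof -
  have "z i \<in> {-B..B}" if "i \<in> {k..<m}" for i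
    using assms(1)[rule_format, of "glue k m x z"] assms(3) that by (auto simp: glue_def abs_le_iff)
  then show ?thesis
    using assms(2) by (auto simp: space_PiM PiE_iff)
qed

lemma integrable_glue:
  assumes "box_fun m g"
  shows "integrable (leb k m) (\<lambda>z. g (glue k m x z))"
proof -
  obtain B where B: "\<forall>x. \<bar>g x\<bar> \<le> B \<and> (g x \<noteq> 0 \<longrightarrow> (\<forall>i<m. \<bar>x i\<bar> \<le> B))"
    and [measurable]: "g \<in> borel_measurable coord_space"
    using assms by (auto simp: box_fun_def)
  have 0: "g (glue k m x z) = 0" if "z \<in> space (leb k m)" "z \<notin> PiE {k..<m} (\<lambda>_. {-B..B})" for z
    using box_fun_glue_support[OF B that(1)] that(2) by blast
  show ?thesis
    by (rule integrableI_bounded_set[where A="PiE {k..<m} (\<lambda>_. {-B..B})" and B=B])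
      (use B emeasure_leb_box 0 in \<open>auto intro!: sets_PiM_I_finite AE_I2 simp flip: less_top\<close>)
qed

lemma part_int_empty [simp]: "part_int k k g x = g x"
proof -
  have "glue k k x z = x" for z
    by (auto simp: glue_def)
  then show ?thesis
    by (simp add: part_int_def PiM_empty lebesgue_integral_count_space_finite)
qed

lemma part_int_support:
  assumes "\<And>x. g x \<noteq> 0 \<Longrightarrow> \<bar>x i\<bar> \<le> B" "part_int k m g x \<noteq> 0" "i < k"
  shows "\<bar>x i\<bar> \<le> B"
proof (rule ccontr)
  assume "\<not> \<bar>x i\<bar> \<le> B"
  then have "g (glue k m x z) = 0" for z
    using assms(1)[of "glue k m x z"] assms(3) by (auto simp: glue_def)
  with assms(2) show False
    by (simp add: part_int_def)
qed

lemma box_fun_part_int: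
  assumes "box_fun m g" "k \<le> m"
  shows "box_fun k (part_int k m g)"
proof -
  obtain B where B: "\<forall>x. \<bar>g x\<bar> \<le> B \<and> (g x \<noteq> 0 \<longrightarrow> (\<forall>i<m. \<bar>x i\<bar> \<le> B))"
    and g[measurable]: "g \<in> borel_measurable coord_space"
    using assms by (auto simp: box_fun_def)
  have B0: "B \<ge> 0"
    using B abs_ge_zero order_trans by blast
  let ?A = "PiE {k..<m} (\<lambda>_. {-B..B})"
  have A[measurable]: "?A \<in> sets (leb k m)"
    by (auto intro!: sets_PiM_I_finite)
  interpret sigma_finite_measure "leb k m" by (rule sigma_finite_leb)
  have "(\<lambda>w. glue k m (fst w) (snd w)) \<in> measurable (coord_space \<Otimes>\<^sub>M leb k m) coord_space"
    by (rule measurable_glue) auto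
  then have "(\<lambda>(x, z). g (glue k m x z)) \<in> borel_measurable (coord_space \<Otimes>\<^sub>M leb k m)"
    unfolding split_beta by (rule measurable_compose) (rule g)
  then have meas: "part_int k m g \<in> borel_measurable coord_space"
    unfolding part_int_def[abs_def] by (rule borel_measurable_lebesgue_integral)
  have bound: "\<bar>part_int k m g x\<bar> \<le> B * measure (leb k m) ?A" for x
  proof -
    have "norm (part_int k m g x) \<le> (\<integral>z. norm (g (glue k m x z)) \<partial>leb k m)"
      unfolding part_int_def by (rule integral_norm_bound)
    also have "\<dots> \<le> (\<integral>z. B * indicator ?A z \<partial>leb k m)"
    proof (rule integral_mono[OF integrable_norm[OF integrable_glue[OF assms(1)]]])
      show "integrable (leb k m) (\<lambda>z. B * indicator ?A z)"
        using emeasure_leb_box A by (intro integrable_mult_right integrable_real_indicator) auto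
      show "norm (g (glue k m x z)) \<le> B * indicator ?A z" if "z \<in> space (leb k m)" for z
        using box_fun_glue_support[OF B that, of x] B B0 by (auto simp: indicator_def)
    qed
    finally show ?thesis using A by simp
  qed
  have supp: "\<bar>x i\<bar> \<le> B" if "part_int k m g x \<noteq> 0" "i < k" for x i
    using that B assms(2) by (intro part_int_support[of g i B k m x]) auto
  \<comment> \<open>Integration multiplies the bound on values by at most the volume of the support
    box, while the support bound B survives.\<close>
  let ?C = "max B (B * measure (leb k m) ?A)"
  have "\<bar>part_int k m g x\<bar> \<le> ?C \<and> (part_int k m g x \<noteq> 0 \<longrightarrow> (\<forall>i<k. \<bar>x i\<bar> \<le> ?C))" for x
    using bound[of x] supp[of x] by (auto simp: le_max_iff_disj)
  with meas show ?thesis unfolding box_fun_def by blast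
qed

section \<open>Fubini for ranges of coordinates\<close>

lemma measurable_upd_comp:
  assumes "g \<in> borel_measurable coord_space"
  shows "(\<lambda>t. g (x(j := t))) \<in> borel_measurable borel"
  by (rule measurable_compose[OF measurable_coord_spaceI assms]) (simp add: fun_upd_def)

text \<open>Isolates the lowest coordinate, in which a sum will be traded for an integral;
  \<open>part_int_inner\<close> isolates the highest one, in which a cell is a segment.\<close>

lemma part_int_outer:
  assumes g: "box_fun m g" and k: "k < m"
  shows "part_int k m g x = (\<integral>t. part_int (Suc k) m g (x(k := t)) \<partial>lborel)"
proof -
  have I: "{k..<m} = {k} \<union> {Suc k..<m}"
    using k by auto
  have eq: "glue k m x (merge {k} {Suc k..<m} (y, z)) = glue (Suc k) m (x(k := y k)) z" for y z
  proof
    fix i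
    consider "i < k" | "i = k" | "k < i" by linarith
    then show "glue k m x (merge {k} {Suc k..<m} (y, z)) i = glue (Suc k) m (x(k := y k)) z i"
      using k by cases (simp_all add: glue_def merge_def)
  qed
  have "part_int k m g x = (\<integral>y. (\<integral>z. g (glue k m x (merge {k} {Suc k..<m} (y, z))) \<partial>leb (Suc k) m) \<partial>PiM {k} (\<lambda>_. lborel))"
    unfolding part_int_def using integrable_glue[OF g, of k x]
    unfolding I by (subst lborel_prod.product_integral_fold) auto
  also have "\<dots> = (\<integral>y. part_int (Suc k) m g (x(k := y k)) \<partial>PiM {k} (\<lambda>_. lborel))"
    unfolding part_int_def eq ..
  also have "\<dots> = (\<integral>t. part_int (Suc k) m g (x(k := t)) \<partial>lborel)"
    by (rule lborel_prod.product_integral_singleton)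
      (use measurable_upd_comp[OF box_funD_measurable[OF box_fun_part_int[OF g, of "Suc k"]]] k in auto)
  finally show ?thesis .
qed

lemma part_int_single:
  assumes "box_fun (Suc m) g"
  shows "part_int m (Suc m) g x = (\<integral>u. g (x(m := u)) \<partial>lborel)"
  using part_int_outer[OF assms, of m x] by simp

lemma part_int_inner:
  assumes g: "box_fun (Suc m) g" and k: "k \<le> m"
  shows "part_int k (Suc m) g x = part_int k m (part_int m (Suc m) g) x"
proof -
  have I: "{k..<Suc m} = insert m {k..<m}"
    using k by auto
  have "part_int k (Suc m) g x = (\<integral>z. (\<integral>u. g (glue k (Suc m) x (z(m := u))) \<partial>lborel) \<partial>leb k m)"
    unfolding part_int_def using integrable_glue[OF g, of k x]
    unfolding I by (subst lborel_prod.product_integral_insert) auto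
  also have "\<dots> = part_int k m (part_int m (Suc m) g) x"
    unfolding part_int_def[of k m] part_int_single[OF g] using k
    by (intro Bochner_Integration.integral_cong refl arg_cong[where f=g])
      (auto simp: glue_def fun_eq_iff)
  finally show ?thesis .
qed

text \<open>On each line in direction j the functional has nonzero slope and hence a single zero;
  Fubini in coordinate j makes the zero set null.\<close>

lemma AE_aff_val_nonzero:
  assumes "k \<le> j" "j < d" "d \<le> m" "snd g j \<noteq> 0"
  shows "AE z in leb k m. aff_val d g (glue k m x z) \<noteq> 0"
proof -
  let ?A = "{z \<in> space (leb k m). aff_val d g (glue k m x z) = 0}"
  let ?I = "{k..<m} - {j}"
  have [measurable]: "(\<lambda>z. aff_val d g (glue k m x z)) \<in> borel_measurable (leb k m)"
    by (rule measurable_compose[OF measurable_glue_const borel_measurable_aff_val])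
  have A: "?A \<in> sets (leb k m)" by measurable
  have I: "{k..<m} = insert j ?I" using assms by auto
  have "emeasure (leb k m) ?A = (\<integral>\<^sup>+z. indicator ?A z \<partial>leb k m)"
    using A by simp
  also have "\<dots> = integral\<^sup>N (PiM (insert j ?I) (\<lambda>_. lborel)) (indicator ?A)"
    unfolding I[symmetric] by simp
  also have "\<dots> = (\<integral>\<^sup>+z. (\<integral>\<^sup>+u. indicator ?A (z(j := u)) \<partial>lborel) \<partial>PiM ?I (\<lambda>_. lborel))"
  proof (rule lborel_prod.product_nn_integral_insert)
    show "indicator ?A \<in> borel_measurable (PiM (insert j ?I) (\<lambda>_. lborel))"
      unfolding I[symmetric] by (rule borel_measurable_indicator[OF A])
  qed auto
  also have "\<dots> = (\<integral>\<^sup>+z. 0 \<partial>PiM ?I (\<lambda>_. lborel :: real measure))"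
  proof (rule nn_integral_cong)
    fix z
    let ?a = "aff_val d g ((glue k m x z)(j := 0))"
    have "indicator ?A (z(j := u)) \<le> (indicator {- ?a / snd g j} u :: ennreal)" for u
    proof (cases "z(j := u) \<in> ?A")
      case True
      have "glue k m x (z(j := u)) = ((glue k m x z)(j := 0))(j := u)"
        using assms by (auto simp: glue_def fun_eq_iff)
      with True have "0 = aff_val d g (((glue k m x z)(j := 0))(j := u))" by simp
      also have "\<dots> = ?a + snd g j * u"
        using assms(2) by (subst aff_val_upd_less) auto
      finally have "u = - ?a / snd g j"
        using assms by (simp add: field_simps)
      then show ?thesis by (auto simp: indicator_def)
    qed simp
    then have "(\<integral>\<^sup>+u. indicator ?A (z(j := u)) \<partial>lborel) \<le> (\<integral>\<^sup>+u. indicator {- ?a / snd g j} u \<partial>lborel)"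
      by (intro nn_integral_mono)
    then show "(\<integral>\<^sup>+u. indicator ?A (z(j := u)) \<partial>lborel) = 0"
      by simp
  qed
  finally have "emeasure (leb k m) ?A = 0" by simp
  then show ?thesis
    using A by (intro AE_I[where N="?A"]) auto
qed

section \<open>Derivative of section volumes\<close>

text \<open>Constraints with positive b bound t from below and those with negative b from above, so
  the set is the interval from the largest lower to the smallest upper bound; \<open>max 0\<close>
  covers the empty case.\<close>

lemma gap_length:
  fixes b y :: "'a \<Rightarrow> real"
  assumes fin: "finite S" and nz: "\<And>s. s \<in> S \<Longrightarrow> b s \<noteq> 0"
    and pos: "{s\<in>S. 0 < b s} \<noteq> {}" and neg: "{s\<in>S. b s < 0} \<noteq> {}"
  shows "measure lborel {t. \<forall>s\<in>S. 0 \<le> b s * (t - y s)}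
    = max 0 (Min (y ` {s\<in>S. b s < 0}) - Max (y ` {s\<in>S. 0 < b s}))"
proof -
  have "(\<forall>s\<in>S. 0 \<le> b s * (t - y s)) \<longleftrightarrow> Max (y ` {s\<in>S. 0 < b s}) \<le> t \<and> t \<le> Min (y ` {s\<in>S. b s < 0})" for t
  proof -
    have "0 \<le> b s * (t - y s) \<longleftrightarrow> (0 < b s \<longrightarrow> y s \<le> t) \<and> (b s < 0 \<longrightarrow> t \<le> y s)" if "s \<in> S" for s
      using nz[OF that] by (auto simp: zero_le_mult_iff)
    then show ?thesis
      using fin pos neg by (subst Max_le_iff Min_ge_iff; force)+
  qed
  then have "{t. \<forall>s\<in>S. 0 \<le> b s * (t - y s)} = {Max (y ` {s\<in>S. 0 < b s})..Min (y ` {s\<in>S. b s < 0})}"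
    by auto
  then show ?thesis by (simp add: measure_def emeasure_lborel_Icc_eq max_def)
qed

lemma continuous_on_Max_image:
  fixes f :: "'a \<Rightarrow> 'b::topological_space \<Rightarrow> real"
  assumes "finite I" "I \<noteq> {}" "\<And>i. i \<in> I \<Longrightarrow> continuous_on A (f i)"
  shows "continuous_on A (\<lambda>x. Max ((\<lambda>i. f i x) ` I))"
  using assms by (induction I rule: finite_ne_induct) (auto intro!: continuous_on_max)

lemma continuous_on_Min_image:
  fixes f :: "'a \<Rightarrow> 'b::topological_space \<Rightarrow> real"
  assumes "finite I" "I \<noteq> {}" "\<And>i. i \<in> I \<Longrightarrow> continuous_on A (f i)"
  shows "continuous_on A (\<lambda>x. Min ((\<lambda>i. f i x) ` I))"
  using assms by (induction I rule: finite_ne_induct) (auto intro!: continuous_on_min)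

text \<open>The length is the positive part of a lower envelope of lines minus an upper envelope.
  Off the finitely many crossings its derivative is the slope of the active upper bound minus that
  of the active lower bound, or 0 when the gap is empty. The \<open>of_bool\<close> factor detects
  the active lines, and \<open>- sgn (b s)\<close> is +1 for upper and -1 for lower bounds.\<close>

lemma gap_length_has_integral:
  fixes b p q :: "'a \<Rightarrow> real" and h :: "'a \<Rightarrow> real \<Rightarrow> real"
  assumes fin: "finite S" and nz: "\<And>s. s \<in> S \<Longrightarrow> b s \<noteq> 0"
    and pos: "{s\<in>S. 0 < b s} \<noteq> {}" and neg: "{s\<in>S. b s < 0} \<noteq> {}"
    and h: "\<And>s \<tau>. s \<in> S \<Longrightarrow> h s \<tau> = p s + q s * \<tau>"
    and distinct: "\<And>s s'. s \<in> S \<Longrightarrow> s' \<in> S \<Longrightarrow> s \<noteq> s' \<Longrightarrow> p s \<noteq> p s' \<or> q s \<noteq> q s'"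
    and ac: "a \<le> c"
  shows "((\<lambda>\<tau>. \<Sum>s\<in>S. - sgn (b s) * q s * of_bool (\<forall>s'\<in>S - {s}. 0 \<le> b s' * (h s \<tau> - h s' \<tau>))) has_integral
      (measure lborel {t. \<forall>s\<in>S. 0 \<le> b s * (t - h s c)} - measure lborel {t. \<forall>s\<in>S. 0 \<le> b s * (t - h s a)})) {a..c}"
proof -
  define P where "P = {s\<in>S. 0 < b s}"
  define N where "N = {s\<in>S. b s < 0}"
  have PN: "finite P" "finite N" "P \<noteq> {}" "N \<noteq> {}" "P \<subseteq> S" "N \<subseteq> S" "P \<inter> N = {}" "P \<union> N = S"
    using fin pos neg nz by (auto simp: P_def N_def) (metis linorder_neqE)
  define lo where "lo = (\<lambda>\<tau>. Max ((\<lambda>s. h s \<tau>) ` P))"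
  define hi where "hi = (\<lambda>\<tau>. Min ((\<lambda>s. h s \<tau>) ` N))"
  have len: "measure lborel {t. \<forall>s\<in>S. 0 \<le> b s * (t - h s \<tau>)} = max 0 (hi \<tau> - lo \<tau>)" for \<tau>
    using gap_length[OF fin nz pos neg, of "\<lambda>s. h s \<tau>"] by (simp add: lo_def hi_def P_def N_def)
  have cont: "continuous_on A (h s)" if "s \<in> S" for s A
    using h[OF that] by (simp add: continuous_intros)
  \<comment> \<open>Crossings of two lines, the only places where an active line can change.
    Distinct lines cross at most once.\<close>
  define X where "X = (\<Union>s\<in>S. \<Union>s'\<in>S - {s}. {\<tau>. h s \<tau> = h s' \<tau>})"
  have "finite {\<tau>. h s \<tau> = h s' \<tau>}" if "s \<in> S" "s' \<in> S - {s}" for s s'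
  proof (rule finite_subset)
    show "{\<tau>. h s \<tau> = h s' \<tau>} \<subseteq> {(p s' - p s) / (q s - q s')}"
    proof clarify
      fix \<tau> assume "h s \<tau> = h s' \<tau>"
      then have "(q s - q s') * \<tau> = p s' - p s"
        using h that by (simp add: algebra_simps)
      moreover from this have "q s \<noteq> q s'"
        using distinct[of s s'] that by auto
      ultimately show "\<tau> = (p s' - p s) / (q s - q s')"
        by (simp add: field_simps)
    qed
  qed simp
  then have finX: "finite X"
    using fin by (auto simp: X_def)
  show ?thesis
    unfolding len
  proof (rule fundamental_theorem_of_calculus_interior_strong[OF finX ac])
    show "continuous_on {a..c} (\<lambda>\<tau>. max 0 (hi \<tau> - lo \<tau>))"
      unfolding hi_def lo_def using PN cont
      by (intro continuous_on_max continuous_on_const continuous_on_diff continuous_on_Min_image continuous_on_Max_image) auto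
  next
    fix \<tau> assume "\<tau> \<in> {a<..<c} - X"
    then have dis: "h s \<tau> \<noteq> h s' \<tau>" if "s \<in> S" "s' \<in> S" "s \<noteq> s'" for s s'
      using that by (auto simp: X_def)
    have "lo \<tau> \<in> (\<lambda>s. h s \<tau>) ` P"
      unfolding lo_def using PN by (intro Max_in) auto
    then obtain s0 where s0: "s0 \<in> P" "lo \<tau> = h s0 \<tau>" by auto
    have "hi \<tau> \<in> (\<lambda>s. h s \<tau>) ` N"
      unfolding hi_def using PN by (intro Min_in) auto
    then obtain s1 where s1: "s1 \<in> N" "hi \<tau> = h s1 \<tau>" by auto
    have s01: "s0 \<in> S" "s1 \<in> S" "s0 \<noteq> s1" "0 < b s0" "b s1 < 0"
      using s0 s1 PN by (auto simp: P_def N_def)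
    have le0: "h s \<tau> \<le> h s0 \<tau>" if "s \<in> P" for s
      using that PN s0(2)[symmetric] by (simp add: lo_def)
    have le1: "h s1 \<tau> \<le> h s \<tau>" if "s \<in> N" for s
      using that PN s1(2)[symmetric] by (simp add: hi_def)
    have ev: "\<forall>\<^sub>F x in nhds \<tau>. h s x < h s' x" if "s \<in> S" "s' \<in> S" "h s \<tau> < h s' \<tau>" for s s'
    proof -
      have "isCont (\<lambda>x. h s' x - h s x) \<tau>"
        using that by (simp add: h continuous_intros)
      then have "((\<lambda>x. h s' x - h s x) \<longlongrightarrow> h s' \<tau> - h s \<tau>) (nhds \<tau>)"
        using tendsto_at_iff_tendsto_nhds[of "\<lambda>x. h s' x - h s x" \<tau>] by (simp add: continuous_at)
      then have "\<forall>\<^sub>F x in nhds \<tau>. 0 < h s' x - h s x"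
        by (rule order_tendstoD) (use that in simp)
      then show ?thesis by simp
    qed
    have "\<forall>\<^sub>F x in nhds \<tau>. \<forall>s\<in>P. h s x \<le> h s0 x"
    proof (rule eventually_ball_finite[OF PN(1)], rule ballI)
      fix s assume s: "s \<in> P"
      show "\<forall>\<^sub>F x in nhds \<tau>. h s x \<le> h s0 x"
      proof (cases "s = s0")
        case False
        then have "h s \<tau> < h s0 \<tau>"
          using le0[OF s] dis[of s s0] s s01 PN by auto
        from ev[OF _ _ this] s PN s01 have "\<forall>\<^sub>F x in nhds \<tau>. h s x < h s0 x" by blast
        then show ?thesis by (rule eventually_mono) simp
      qed simp
    qed
    then have ev0: "\<forall>\<^sub>F x in nhds \<tau>. lo x = h s0 x"
      by (rule eventually_mono) (use PN s0 in \<open>auto simp: lo_def intro!: Max_eqI\<close>)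
    have "\<forall>\<^sub>F x in nhds \<tau>. \<forall>s\<in>N. h s1 x \<le> h s x"
    proof (rule eventually_ball_finite[OF PN(2)], rule ballI)
      fix s assume s: "s \<in> N"
      show "\<forall>\<^sub>F x in nhds \<tau>. h s1 x \<le> h s x"
      proof (cases "s = s1")
        case False
        then have "h s1 \<tau> < h s \<tau>"
          using le1[OF s] dis[of s s1] s s01 PN by force
        from ev[OF _ _ this] s PN s01 have "\<forall>\<^sub>F x in nhds \<tau>. h s1 x < h s x" by blast
        then show ?thesis by (rule eventually_mono) simp
      qed simp
    qed
    then have ev1: "\<forall>\<^sub>F x in nhds \<tau>. hi x = h s1 x"
      by (rule eventually_mono) (use PN s1 in \<open>auto simp: hi_def intro!: Min_eqI\<close>)
    \<comment> \<open>A line meeting all other constraints lies strictly above \<open>s0\<close>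
      unless it is \<open>s0\<close>, and strictly below \<open>s1\<close> unless it is
      \<open>s1\<close>. Extremality of these two leaves no further candidate.\<close>
    have feasible: "(\<forall>s'\<in>S - {s}. 0 \<le> b s' * (h s \<tau> - h s' \<tau>)) \<longleftrightarrow> h s0 \<tau> < h s1 \<tau> \<and> (s = s0 \<or> s = s1)"
      if s: "s \<in> S" for s
    proof
      assume L: "\<forall>s'\<in>S - {s}. 0 \<le> b s' * (h s \<tau> - h s' \<tau>)"
      have A: "h s0 \<tau> < h s \<tau>" if "s \<noteq> s0"
        using L[rule_format, of s0] that s01 dis[OF s s01(1)] by (force simp: zero_le_mult_iff)
      have B: "h s \<tau> < h s1 \<tau>" if "s \<noteq> s1"
        using L[rule_format, of s1] that s01 dis[OF s s01(2)] by (force simp: zero_le_mult_iff)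
      show "h s0 \<tau> < h s1 \<tau> \<and> (s = s0 \<or> s = s1)"
      proof (cases "s \<in> P")
        case True
        then show ?thesis using A B le0[of s] s01 by fastforce
      next
        case False
        then have "s \<in> N" using s PN by auto
        then show ?thesis using A B le1[of s] s01 by fastforce
      qed
    next
      assume R: "h s0 \<tau> < h s1 \<tau> \<and> (s = s0 \<or> s = s1)"
      show "\<forall>s'\<in>S - {s}. 0 \<le> b s' * (h s \<tau> - h s' \<tau>)"
      proof
        fix s' assume s': "s' \<in> S - {s}"
        show "0 \<le> b s' * (h s \<tau> - h s' \<tau>)"
        proof (cases "s' \<in> P")
          case True
          then show ?thesis using R le0[OF True] by (auto simp: P_def zero_le_mult_iff)
        next
          case False
          then have "s' \<in> N" using s' PN by auto
          then show ?thesis using R le1[of s'] by (auto simp: N_def zero_le_mult_iff)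
        qed
      qed
    qed
    let ?D = "\<Sum>s\<in>S. - sgn (b s) * q s * of_bool (\<forall>s'\<in>S - {s}. 0 \<le> b s' * (h s \<tau> - h s' \<tau>))"
    have D: "?D = (if h s0 \<tau> < h s1 \<tau> then q s1 - q s0 else 0)"
    proof -
      have "?D = (\<Sum>s\<in>S. - sgn (b s) * q s * of_bool (h s0 \<tau> < h s1 \<tau> \<and> (s = s0 \<or> s = s1)))"
        by (intro sum.cong refl) (simp only: feasible)
      also have "\<dots> = (\<Sum>s\<in>{s0, s1}. - sgn (b s) * q s * of_bool (h s0 \<tau> < h s1 \<tau>))"
        using s01 fin by (intro sum.mono_neutral_cong_right) auto
      finally show ?thesis using s01 by simp
    qed
    have "((\<lambda>\<tau>. max 0 (hi \<tau> - lo \<tau>)) has_real_derivative ?D) (at \<tau>)"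
    proof (cases "h s0 \<tau> < h s1 \<tau>")
      case True
      have "\<forall>\<^sub>F x in nhds \<tau>. max 0 (hi x - lo x) = (p s1 + q s1 * x) - (p s0 + q s0 * x)"
        using ev0 ev1 ev[OF s01(1,2) True]
        by eventually_elim (use h s01 in auto)
      moreover have "((\<lambda>x. (p s1 + q s1 * x) - (p s0 + q s0 * x)) has_real_derivative q s1 - q s0) (at \<tau>)"
        by (auto intro!: derivative_eq_intros)
      ultimately show ?thesis
        unfolding D using True by (subst DERIV_cong_ev[OF refl _ refl]) auto
    next
      case False
      then have "h s1 \<tau> < h s0 \<tau>"
        using dis[OF s01(1,2,3)] by simp
      from ev[OF s01(2,1) this] ev0 ev1 have "\<forall>\<^sub>F x in nhds \<tau>. max 0 (hi x - lo x) = 0"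
        by eventually_elim auto
      then show ?thesis
        unfolding D using False by (subst DERIV_cong_ev[OF refl _ refl]) auto
    qed
    then show "((\<lambda>\<tau>. max 0 (hi \<tau> - lo \<tau>)) has_vector_derivative ?D) (at \<tau>)"
      by (simp add: has_real_derivative_iff_has_vector_derivative)
  qed
qed

section \<open>Lengths of the vertical fibres of a simplex\<close>

abbreviation cell_ind :: "nat \<Rightarrow> (point \<Rightarrow> aff_fun) \<Rightarrow> point set \<Rightarrow> point \<Rightarrow> real"
  where "cell_ind d f S \<equiv> indicator (cell d f S)"

lemma cell_measurable: "finite S \<Longrightarrow> cell d f S \<in> sets coord_space"
proof -
  assume "finite S"
  then have "{x \<in> space coord_space. \<forall>s\<in>S. 0 \<le> aff_val d (f s) x} \<in> sets coord_space"
    by measurable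
  then show ?thesis by (simp add: cell_def space_PiM)
qed

lemma lattice_simplex_bounded:
  assumes "lattice_simplex d f S" "x \<in> cell d f S" "i < d" "\<And>s. s \<in> S \<Longrightarrow> \<bar>s i\<bar> \<le> B"
  shows "\<bar>x i\<bar> \<le> B"
  using assms cell_bounded by (auto simp: lattice_simplex_def)

lemma box_fun_indicator:
  assumes "A \<in> sets coord_space" "\<And>x i. x \<in> A \<Longrightarrow> i < d \<Longrightarrow> \<bar>x i\<bar> \<le> B"
  shows "box_fun d (indicator A)"
  unfolding box_fun_def
proof (intro conjI exI[of _ "max 1 B"] allI impI)
  show "indicator A \<in> borel_measurable coord_space"
    using assms(1) by simp
next
  fix x show "\<bar>indicator A x :: real\<bar> \<le> max 1 B"
    by (auto simp: indicator_def)
next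
  fix x i assume "(indicator A x :: real) \<noteq> 0" "i < d"
  then have "x \<in> A" by (auto simp: indicator_def split: if_splits)
  then show "\<bar>x i\<bar> \<le> max 1 B" using assms(2) \<open>i < d\<close> by (auto simp: le_max_iff_disj)
qed

lemma finite_coords_bounded:
  fixes S :: "(nat \<Rightarrow> real) set"
  assumes "finite S"
  obtains B where "\<And>s i. s \<in> S \<Longrightarrow> i < d \<Longrightarrow> \<bar>s i\<bar> \<le> (B::real)"
proof
  fix s i assume si: "s \<in> S" "i < d"
  have "\<bar>s i\<bar> \<le> (\<Sum>i<d. \<bar>s i\<bar>)"
    using si by (intro member_le_sum) auto
  also have "\<dots> \<le> (\<Sum>s\<in>S. \<Sum>i<d. \<bar>s i\<bar>)"
    using si assms by (intro member_le_sum[where f="\<lambda>s. \<Sum>i<d. \<bar>s i\<bar>"]) (auto intro: sum_nonneg)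
  finally show "\<bar>s i\<bar> \<le> (\<Sum>s\<in>S. \<Sum>i<d. \<bar>s i\<bar>)" .
qed

lemma box_fun_cell:
  assumes "lattice_simplex d f S"
  shows "box_fun d (cell_ind d f S)"
proof -
  have fin: "finite S" using assms by (rule lattice_simplex_finite)
  obtain B where "\<And>s i. s \<in> S \<Longrightarrow> i < d \<Longrightarrow> \<bar>s i\<bar> \<le> B"
    using finite_coords_bounded[OF fin] by metis
  with lattice_simplex_bounded[OF assms] show ?thesis
    by (intro box_fun_indicator[of _ d B] cell_measurable fin) blast+
qed

lemma part_int_indicator_single:
  assumes "box_fun (Suc d) (indicator A)" 
  shows "part_int d (Suc d) (indicator A) x = measure lborel {t. x(d := t) \<in> A}"
proof -
  have "part_int d (Suc d) (indicator A) x = (\<integral>t. indicator {t. x(d := t) \<in> A} t \<partial>lborel)"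
    unfolding part_int_single[OF assms]
    by (intro Bochner_Integration.integral_cong) (auto simp: indicator_def)
  then show ?thesis by simp
qed

lemma height_upd_ge: "d \<le> j \<Longrightarrow> height d g (x(j := t)) = height d g x"
  by (simp add: height_def aff_val_upd_ge)

lemma height_upd_less:
  "k < d \<Longrightarrow> height d g (x(k := t)) = height d g (x(k := 0)) + (- snd g k / snd g d) * t"
  using aff_val_upd_less[of k d g "x(k := 0)" t]
  by (simp add: height_def add_divide_distrib diff_divide_distrib)

lemma cell_upd_iff:
  assumes "lattice_simplex (Suc d) f S"
  shows "x(d := t) \<in> cell (Suc d) f S \<longleftrightarrow> (\<forall>s\<in>S. 0 \<le> snd (f s) d * (t - height d (f s) x))"
  using lattice_simplex_slope[OF assms] by (simp add: cell_def aff_val_height height_upd_ge)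

lemma facet_cell_iff:
  assumes "lattice_simplex (Suc d) f S" "s \<in> S"
  shows "x \<in> cell d (facet_family d s f) (S - {s}) \<longleftrightarrow>
    (\<forall>s'\<in>S - {s}. 0 \<le> snd (f s') d * (height d (f s) x - height d (f s') x))"
  using lattice_simplex_slope[OF assms(1)] assms(2) by (simp add: cell_def facet_family_height_diff)

text \<open>The slopes are nonzero and sum to 0, so both signs occur; every fibre is therefore
  bounded on both sides.\<close>

lemma lattice_simplex_slope_signs:
  assumes S: "lattice_simplex (Suc d) f S"
  shows "{s\<in>S. 0 < snd (f s) d} \<noteq> {}" "{s\<in>S. snd (f s) d < 0} \<noteq> {}"
proof -
  have fin: "finite S" and "S \<noteq> {}" and bary: "barycentric (Suc d) f S"
    using S lattice_simplex_finite[OF S] by (auto simp: lattice_simplex_def)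
  note 0 = barycentric_slope_sum(1)[OF bary]
  have "\<exists>s\<in>S. 0 < snd (f s) d"
  proof (rule ccontr)
    assume "\<not> ?thesis"
    then have "(\<Sum>s\<in>S. snd (f s) d) < (\<Sum>s\<in>S. 0)"
      using lattice_simplex_slope[OF S] fin \<open>S \<noteq> {}\<close> by (intro sum_strict_mono) (auto simp: not_less less_le)
    with 0 show False by simp
  qed
  then show "{s\<in>S. 0 < snd (f s) d} \<noteq> {}" by auto
  have "\<exists>s\<in>S. snd (f s) d < 0"
  proof (rule ccontr)
    assume "\<not> ?thesis"
    then have "(\<Sum>s\<in>S. 0) < (\<Sum>s\<in>S. snd (f s) d)"
      using lattice_simplex_slope[OF S] fin \<open>S \<noteq> {}\<close> by (intro sum_strict_mono) (auto simp: not_less less_le)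
    with 0 show False by simp
  qed
  then show "{s\<in>S. snd (f s) d < 0} \<noteq> {}" by auto
qed

text \<open>The slope in direction \<open>k\<close> of the graph carrying the facet, signed by whether the
  facet bounds the vertical fibres from above or from below.\<close>

definition facet_weight :: "nat \<Rightarrow> nat \<Rightarrow> aff_fun \<Rightarrow> real"
  where "facet_weight k d g = - sgn (snd g d) * (- snd g k / snd g d)"

text \<open>Fubini applies because the indicator bounds the support in direction
  \<open>\<tau>\<close> and \<open>box_fun\<close> bounds it in the integrated coordinates.\<close>

lemma part_int_integral_swap:
  assumes D: "box_fun d D"
  shows "(\<integral>z. (\<integral>\<tau>. indicator {a..c} \<tau> * D (glue (Suc k) d (y(k := \<tau>)) z) \<partial>lborel) \<partial>leb (Suc k) d)
    = (\<integral>\<tau>. indicator {a..c} \<tau> * part_int (Suc k) d D (y(k := \<tau>)) \<partial>lborel)"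
    and "(\<lambda>z. \<integral>\<tau>. indicator {a..c} \<tau> * D (glue (Suc k) d (y(k := \<tau>)) z) \<partial>lborel)
      \<in> borel_measurable (leb (Suc k) d)"
proof -
  let ?L = "leb (Suc k) d"
  obtain B where B: "\<forall>x. \<bar>D x\<bar> \<le> B \<and> (D x \<noteq> 0 \<longrightarrow> (\<forall>i<d. \<bar>x i\<bar> \<le> B))"
    and Dm: "D \<in> borel_measurable coord_space"
    using D by (auto simp: box_fun_def)
  interpret L: sigma_finite_measure ?L by (rule sigma_finite_leb)
  interpret pair_sigma_finite lborel ?L ..
  let ?A = "PiE {Suc k..<d} (\<lambda>_. {-B..B})"
  let ?h = "\<lambda>\<tau> z. indicator {a..c} \<tau> * D (glue (Suc k) d (y(k := \<tau>)) z)"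
  have "(\<lambda>w. glue (Suc k) d (y(k := fst w)) (snd w)) \<in> measurable (lborel \<Otimes>\<^sub>M ?L) coord_space"
    by (rule measurable_glue) auto
  from measurable_compose[OF this Dm]
  have [measurable]: "(\<lambda>w. D (glue (Suc k) d (y(k := fst w)) (snd w))) \<in> borel_measurable (lborel \<Otimes>\<^sub>M ?L)" .
  have [measurable]: "(\<lambda>(\<tau>, z). ?h \<tau> z) \<in> borel_measurable (lborel \<Otimes>\<^sub>M ?L)"
    unfolding split_beta by measurable
  have int: "integrable (lborel \<Otimes>\<^sub>M ?L) (\<lambda>(\<tau>, z). ?h \<tau> z)"
  proof (rule integrableI_bounded_set[where A="{a..c} \<times> ?A" and B="B"])
    show "{a..c} \<times> ?A \<in> sets (lborel \<Otimes>\<^sub>M ?L)"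
      by (intro pair_measureI) (auto intro!: sets_PiM_I_finite)
    show "emeasure (lborel \<Otimes>\<^sub>M ?L) ({a..c} \<times> ?A) < \<infinity>"
      using emeasure_leb_box[of "Suc k" d B]
      by (subst L.emeasure_pair_measure_Times)
        (auto intro!: sets_PiM_I_finite simp: emeasure_lborel_Icc_eq ennreal_mult_less_top)
    have B0: "0 \<le> B" using B abs_ge_zero order_trans by blast
    show "AE x\<in>{a..c} \<times> ?A in lborel \<Otimes>\<^sub>M ?L. norm ((\<lambda>(\<tau>, z). ?h \<tau> z) x) \<le> B"
      using B B0 by (auto intro!: AE_I2 simp: indicator_def)
    show "AE w in lborel \<Otimes>\<^sub>M ?L. w \<notin> {a..c} \<times> ?A \<longrightarrow> (\<lambda>(\<tau>, z). ?h \<tau> z) w = 0"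
    proof (rule AE_I2, rule impI)
      fix w assume w: "w \<in> space (lborel \<Otimes>\<^sub>M ?L)" "w \<notin> {a..c} \<times> ?A"
      show "(\<lambda>(\<tau>, z). ?h \<tau> z) w = 0"
      proof (cases w)
        case (Pair \<tau> z)
        then show ?thesis
          using box_fun_glue_support[OF B, of z "Suc k" "y(k := \<tau>)"] w
          by (auto simp: indicator_def space_pair_measure)
      qed
    qed
  qed simp
  show "(\<integral>z. (\<integral>\<tau>. ?h \<tau> z \<partial>lborel) \<partial>?L) = (\<integral>\<tau>. indicator {a..c} \<tau> * part_int (Suc k) d D (y(k := \<tau>)) \<partial>lborel)"
    using Fubini_integral[OF int] by (simp add: part_int_def)
  show "(\<lambda>z. \<integral>\<tau>. ?h \<tau> z \<partial>lborel) \<in> borel_measurable ?L"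
  proof (rule lborel.borel_measurable_lebesgue_integral)
    show "(\<lambda>(z, \<tau>). ?h \<tau> z) \<in> borel_measurable (?L \<Otimes>\<^sub>M lborel)"
      using measurable_compose[OF measurable_pair_swap' \<open>(\<lambda>(\<tau>, z). ?h \<tau> z) \<in> borel_measurable (lborel \<Otimes>\<^sub>M ?L)\<close>]
      by (simp add: split_beta)
  qed
qed

lemma box_fun_lincomb:
  assumes "finite S" "\<And>s. s \<in> S \<Longrightarrow> box_fun d (g s)"
  shows "box_fun d (\<lambda>x. \<Sum>s\<in>S. c s * g s x)"
  using assms
proof (induction S rule: finite_induct)
  case empty
  show ?case by (auto simp: box_fun_def)
next
  case (insert s S)
  obtain B1 where B1: "\<forall>x. \<bar>g s x\<bar> \<le> B1 \<and> (g s x \<noteq> 0 \<longrightarrow> (\<forall>i<d. \<bar>x i\<bar> \<le> B1))"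
    and m1: "g s \<in> borel_measurable coord_space"
    using insert.prems[of s] by (auto simp: box_fun_def)
  obtain B2 where B2: "\<forall>x. \<bar>\<Sum>s\<in>S. c s * g s x\<bar> \<le> B2 \<and> ((\<Sum>s\<in>S. c s * g s x) \<noteq> 0 \<longrightarrow> (\<forall>i<d. \<bar>x i\<bar> \<le> B2))"
    and m2: "(\<lambda>x. \<Sum>s\<in>S. c s * g s x) \<in> borel_measurable coord_space"
    using insert.IH[OF insert.prems] by (auto simp: box_fun_def)
  note B = B1 B2 and m = m1 m2
  let ?B = "max (max B1 B2) (\<bar>c s\<bar> * B1 + B2)"
  have "\<bar>\<Sum>s\<in>insert s S. c s * g s x\<bar> \<le> ?B \<and> ((\<Sum>s\<in>insert s S. c s * g s x) \<noteq> 0 \<longrightarrow> (\<forall>i<d. \<bar>x i\<bar> \<le> ?B))" for x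
  proof
    have "\<bar>c s * g s x\<bar> \<le> \<bar>c s\<bar> * B1"
      using B(1) by (simp add: abs_mult mult_left_mono)
    then have "\<bar>c s * g s x + (\<Sum>s\<in>S. c s * g s x)\<bar> \<le> \<bar>c s\<bar> * B1 + B2"
      using B(2) by (intro order_trans[OF abs_triangle_ineq] add_mono) auto
    then show "\<bar>\<Sum>s\<in>insert s S. c s * g s x\<bar> \<le> ?B"
      using insert by (simp add: le_max_iff_disj)
    show "(\<Sum>s\<in>insert s S. c s * g s x) \<noteq> 0 \<longrightarrow> (\<forall>i<d. \<bar>x i\<bar> \<le> ?B)"
      using insert B by (auto simp: le_max_iff_disj) (metis add_0 mult_zero_right)+
  qed
  moreover have "(\<lambda>x. \<Sum>s\<in>insert s S. c s * g s x) \<in> borel_measurable coord_space"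
    using m insert by simp
  ultimately show ?case unfolding box_fun_def by blast
qed

lemma part_int_lincomb:
  assumes "finite S" "\<And>s. s \<in> S \<Longrightarrow> box_fun d (g s)"
  shows "part_int k d (\<lambda>x. \<Sum>s\<in>S. c s * g s x) x = (\<Sum>s\<in>S. c s * part_int k d (g s) x)"
  unfolding part_int_def using assms integrable_glue
  by (subst Bochner_Integration.integral_sum) auto

text \<open>Along a line in direction k the heights of the facets are affine in
  \<open>\<tau>\<close>, so \<open>gap_length_has_integral\<close> applies. The assumption
  \<open>gen\<close> says that no two facet graphs coincide along the whole line: up to a nonzero
  factor, \<open>facet_family\<close> is the difference of their heights.\<close>

lemma cell_length_has_integral:
  assumes S: "lattice_simplex (Suc d) f S" and k: "k < d" and ac: "a \<le> c"
    and gen: "\<And>s s'. s \<in> S \<Longrightarrow> s' \<in> S \<Longrightarrow> s \<noteq> s' \<Longrightarrow>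
      aff_val d (facet_family d s f s') (x(k := 0)) \<noteq> 0 \<or> snd (facet_family d s f s') k \<noteq> 0"
  shows "((\<lambda>\<tau>. \<Sum>s\<in>S. facet_weight k d (f s) * cell_ind d (facet_family d s f) (S - {s}) (x(k := \<tau>))) has_integral
    (part_int d (Suc d) (cell_ind (Suc d) f S) (x(k := c)) - part_int d (Suc d) (cell_ind (Suc d) f S) (x(k := a)))) {a..c}"
proof -
  note nz = lattice_simplex_slope[OF S]
  have len: "part_int d (Suc d) (cell_ind (Suc d) f S) u
      = measure lborel {t. \<forall>s\<in>S. 0 \<le> snd (f s) d * (t - height d (f s) u)}" for u
    using part_int_indicator_single[OF box_fun_cell[OF S], of u] by (simp add: cell_upd_iff[OF S])
  have ind: "cell_ind d (facet_family d s f) (S - {s}) u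
      = of_bool (\<forall>s'\<in>S - {s}. 0 \<le> snd (f s') d * (height d (f s) u - height d (f s') u))" if "s \<in> S" for s u
    using facet_cell_iff[OF S that, of u] by (simp add: indicator_def)
  have "height d (f s) (x(k := 0)) \<noteq> height d (f s') (x(k := 0)) \<or>
      - snd (f s) k / snd (f s) d \<noteq> - snd (f s') k / snd (f s') d" if s: "s \<in> S" "s' \<in> S" "s \<noteq> s'" for s s'
  proof -
    have "snd (facet_family d s f s') k = snd (f s') d * (- snd (f s) k / snd (f s) d - (- snd (f s') k / snd (f s') d))"
      using nz[OF s(1)] nz[OF s(2)] by (simp add: facet_family_def field_simps)
    with gen[OF s] show ?thesis
      using facet_family_height_diff[where f=f and s=s and s'=s' and d=d, OF nz[OF s(1)] nz[OF s(2)]] by auto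
  qed
  from gap_length_has_integral[OF lattice_simplex_finite[OF S] nz lattice_simplex_slope_signs[OF S] height_upd_less[OF k] this ac]
  show ?thesis
    unfolding len facet_weight_def
    by (rule has_integral_eq[rotated]) (use ind in \<open>auto intro!: sum.cong\<close>)
qed

text \<open>Two facets may coincide along a whole line in direction \<open>k < d - 1\<close>, but only for a null set
  of lines, since the projection of their intersection is not vertical in direction \<open>d - 1\<close>.\<close>

lemma AE_glue_general:
  assumes S: "lattice_simplex (Suc d) f S" and k: "k < d"
  shows "AE z in leb (Suc k) d. \<forall>s\<in>S. \<forall>s'\<in>S - {s}.
      aff_val d (facet_family d s f s') ((glue (Suc k) d y z)(k := 0)) \<noteq> 0 \<or> snd (facet_family d s f s') k \<noteq> 0"
proof -
  have fin: "finite S" using S by (rule lattice_simplex_finite)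
  obtain e where e: "d = Suc e" using k by (cases d) auto
  have "AE z in leb (Suc k) d.
      aff_val d (facet_family d s f s') ((glue (Suc k) d y z)(k := 0)) \<noteq> 0 \<or> snd (facet_family d s f s') k \<noteq> 0"
    if s: "s \<in> S" "s' \<in> S - {s}" for s s'
  proof -
    have slope: "snd (facet_family d s f s') e \<noteq> 0"
      using lattice_simplex_slope[of e "facet_family d s f" "S - {s}" s'] lattice_simplex_facet[OF S s(1)] s e
      by simp
    show ?thesis
    proof (cases "e = k")
      case True
      with slope show ?thesis by simp
    next
      case False
      then have "AE z in leb (Suc k) d. aff_val d (facet_family d s f s') (glue (Suc k) d (y(k := 0)) z) \<noteq> 0"
        using slope e k by (intro AE_aff_val_nonzero[where j=e]) auto
      moreover have "glue (Suc k) d (y(k := 0)) z = (glue (Suc k) d y z)(k := 0)" for z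
        by (auto simp: glue_def fun_eq_iff)
      ultimately show ?thesis
        by (intro eventually_mono[of _ _ "\<lambda>z. _ z \<or> _ z", OF _ disjI1]) simp
    qed
  qed
  then show ?thesis
    using fin by (intro AE_finite_allI) auto
qed

text \<open>The derivative formula in integrated form. It needs the fundamental theorem on almost
  every line only, and exchanging two integrals replaces differentiation under the integral
  sign.\<close>

lemma part_int_cell_diff:
  assumes S: "lattice_simplex (Suc d) f S" and k: "k < d" and ac: "a \<le> c"
  shows "part_int (Suc k) (Suc d) (cell_ind (Suc d) f S) (y(k := c)) - part_int (Suc k) (Suc d) (cell_ind (Suc d) f S) (y(k := a))
    = (\<integral>\<tau>. indicator {a..c} \<tau> * (\<Sum>s\<in>S. facet_weight k d (f s) *
        part_int (Suc k) d (cell_ind d (facet_family d s f) (S - {s})) (y(k := \<tau>))) \<partial>lborel)"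
proof -
  define L where "L = part_int d (Suc d) (cell_ind (Suc d) f S)"
  define D where "D = (\<lambda>x. \<Sum>s\<in>S. facet_weight k d (f s) * cell_ind d (facet_family d s f) (S - {s}) x)"
  have fin: "finite S" using S by (rule lattice_simplex_finite)
  have boxL: "box_fun d L"
    unfolding L_def by (rule box_fun_part_int[OF box_fun_cell[OF S]]) simp
  have boxF: "box_fun d (cell_ind d (facet_family d s f) (S - {s}))" if "s \<in> S" for s
    by (rule box_fun_cell[OF lattice_simplex_facet[OF S that]])
  have boxD: "box_fun d D"
    unfolding D_def by (intro box_fun_lincomb fin boxF)
  have L: "part_int (Suc k) (Suc d) (cell_ind (Suc d) f S) x = part_int (Suc k) d L x" for x
    unfolding L_def using k by (intro part_int_inner box_fun_cell[OF S]) auto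
  have upd: "glue (Suc k) d (y(k := t)) z = (glue (Suc k) d y z)(k := t)" for t z
    by (auto simp: glue_def fun_eq_iff)
  have line: "L ((glue (Suc k) d y z)(k := c)) - L ((glue (Suc k) d y z)(k := a))
      = (\<integral>\<tau>. indicator {a..c} \<tau> * D ((glue (Suc k) d y z)(k := \<tau>)) \<partial>lborel)"
    if "\<forall>s\<in>S. \<forall>s'\<in>S - {s}. aff_val d (facet_family d s f s') ((glue (Suc k) d y z)(k := 0)) \<noteq> 0
        \<or> snd (facet_family d s f s') k \<noteq> 0" for z
  proof -
    let ?u = "glue (Suc k) d y z"
    have hi: "((\<lambda>\<tau>. D (?u(k := \<tau>))) has_integral (L (?u(k := c)) - L (?u(k := a)))) {a..c}"
      unfolding D_def L_def using that by (intro cell_length_has_integral[OF S k ac]) auto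
    obtain B where B: "\<And>x. \<bar>D x\<bar> \<le> B"
      using boxD by (auto simp: box_fun_def)
    have "set_integrable lborel {a..c} (\<lambda>\<tau>. D (?u(k := \<tau>)))"
      unfolding set_integrable_def
      by (rule integrableI_bounded_set_indicator[where B=B])
        (use B measurable_upd_comp[OF box_funD_measurable[OF boxD]] in \<open>auto simp: emeasure_lborel_Icc_eq\<close>)
    from set_borel_integral_eq_integral(2)[OF this] integral_unique[OF hi]
    show ?thesis by (simp add: set_lebesgue_integral_def)
  qed
  have "part_int (Suc k) d L (y(k := c)) - part_int (Suc k) d L (y(k := a))
      = (\<integral>z. L (glue (Suc k) d (y(k := c)) z) - L (glue (Suc k) d (y(k := a)) z) \<partial>leb (Suc k) d)"
    unfolding part_int_def by (intro Bochner_Integration.integral_diff[symmetric] integrable_glue boxL)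
  also have "\<dots> = (\<integral>z. (\<integral>\<tau>. indicator {a..c} \<tau> * D (glue (Suc k) d (y(k := \<tau>)) z) \<partial>lborel) \<partial>leb (Suc k) d)"
  proof (rule integral_cong_AE)
    show "(\<lambda>z. L (glue (Suc k) d (y(k := c)) z) - L (glue (Suc k) d (y(k := a)) z)) \<in> borel_measurable (leb (Suc k) d)"
      by (intro borel_measurable_diff borel_measurable_integrable[OF integrable_glue] boxL)
    \<comment> \<open>The exceptional null set consists of the lines along which two facet graphs
      may coincide.\<close>
    show "AE z in leb (Suc k) d. L (glue (Suc k) d (y(k := c)) z) - L (glue (Suc k) d (y(k := a)) z)
        = (\<integral>\<tau>. indicator {a..c} \<tau> * D (glue (Suc k) d (y(k := \<tau>)) z) \<partial>lborel)"
      using AE_glue_general[OF S k, of y] unfolding upd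
      by (rule AE_mp) (rule AE_I2, blast intro: line)
  qed (rule part_int_integral_swap(2)[OF boxD])
  also have "\<dots> = (\<integral>\<tau>. indicator {a..c} \<tau> * part_int (Suc k) d D (y(k := \<tau>)) \<partial>lborel)"
    by (rule part_int_integral_swap(1)[OF boxD])
  finally show ?thesis
    unfolding L unfolding D_def by (subst (asm) part_int_lincomb[OF fin boxF])
qed

section \<open>Sums along lattice lines\<close>

lemma integral_interval_shift:
  fixes g :: "real \<Rightarrow> real"
  shows "(\<integral>\<tau>. indicator {t..t + \<sigma>} \<tau> * g \<tau> \<partial>lborel) = (\<integral>\<tau>. indicator {0..\<sigma>} \<tau> * g (t + \<tau>) \<partial>lborel)"
    and "(\<integral>\<tau>. indicator {t..<t + \<sigma>} \<tau> * g \<tau> \<partial>lborel) = (\<integral>\<tau>. indicator {0..<\<sigma>} \<tau> * g (t + \<tau>) \<partial>lborel)"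
  by (subst lborel_integral_real_affine[where c=1 and t=t];
      auto intro!: Bochner_Integration.integral_cong simp: indicator_def)+

lemma integrable_indicator_line:
  assumes g: "box_fun k g" and A: "A \<in> sets lborel" "emeasure lborel A < \<infinity>"
  shows "integrable lborel (\<lambda>\<tau>. indicator A \<tau> * g (y(j := t + \<tau>)))"
proof -
  obtain B where B: "\<And>x. \<bar>g x\<bar> \<le> B"
    using g by (auto simp: box_fun_def)
  have "(\<lambda>\<tau>. g (y(j := t + \<tau>))) \<in> borel_measurable lborel"
    using measurable_compose[OF _ measurable_upd_comp[OF box_funD_measurable[OF g]], of "\<lambda>\<tau>. t + \<tau>" lborel]
    by simp
  then have "integrable lborel (\<lambda>\<tau>. indicator A \<tau> *\<^sub>R g (y(j := t + \<tau>)))"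
    using A B by (intro integrableI_bounded_set_indicator[where B=B]) auto
  then show ?thesis by simp
qed

text \<open>The sum over all integers, cut off at N. It is used with support inside
  [-(N - 1), N - 1], so shifts by \<open>\<sigma>\<close> between 0 and 1 lose no term.\<close>

definition line_sum :: "int \<Rightarrow> nat \<Rightarrow> (point \<Rightarrow> real) \<Rightarrow> point \<Rightarrow> real \<Rightarrow> real"
  where "line_sum N k g y \<sigma> = (\<Sum>t\<in>{-N..N}. g (y(k := of_int t + \<sigma>)))"

text \<open>Reindexing by t + 1 changes the range only at -N and N + 1, where g vanishes thanks to
  the margin in the support.\<close>

lemma line_sum_periodic:
  assumes "\<And>\<tau>. g (y(k := \<tau>)) \<noteq> 0 \<Longrightarrow> \<bar>\<tau>\<bar> \<le> of_int N - 1" "0 \<le> N"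
  shows "line_sum N k g y 1 = line_sum N k g y 0"
proof -
  have 0: "g (y(k := \<tau>)) = 0" if "\<tau> = - of_int N \<or> \<tau> = of_int N + 1" for \<tau>
    using assms(1)[of \<tau>] assms(2) that by fastforce
  have "line_sum N k g y 1 = (\<Sum>t\<in>{-N..N}. g (y(k := of_int (t + 1))))"
    by (simp add: line_sum_def)
  also have "\<dots> = (\<Sum>t\<in>{-N + 1..N + 1}. g (y(k := of_int t)))"
    by (rule sum.reindex_bij_witness[of _ "\<lambda>t. t - 1" "\<lambda>t. t + 1"]) auto
  also have "\<dots> = (\<Sum>t\<in>{-N..N + 1}. g (y(k := of_int t)))"
  proof (rule sum.mono_neutral_left)
    show "\<forall>t\<in>{-N..N + 1} - {-N + 1..N + 1}. g (y(k := of_int t)) = 0"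
    proof
      fix t assume "t \<in> {-N..N + 1} - {-N + 1..N + 1}"
      then have "t = -N" by auto
      then show "g (y(k := of_int t)) = 0" using 0 by simp
    qed
  qed auto
  also have "\<dots> = (\<Sum>t\<in>{-N..N}. g (y(k := of_int t)))"
  proof (rule sum.mono_neutral_right)
    show "\<forall>t\<in>{-N..N + 1} - {-N..N}. g (y(k := of_int t)) = 0"
    proof
      fix t assume "t \<in> {-N..N + 1} - {-N..N}"
      then have "t = N + 1" by auto
      then show "g (y(k := of_int t)) = 0" using 0 by simp
    qed
  qed auto
  finally show ?thesis by (simp add: line_sum_def)
qed

lemma part_int_cell_support:
  assumes S: "lattice_simplex d f S" and k: "k < m" "k < d" and b: "\<And>s. s \<in> S \<Longrightarrow> \<bar>s k\<bar> \<le> B"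
    and nz: "part_int m n (cell_ind d f S) (y(k := \<tau>)) \<noteq> 0"
  shows "\<bar>\<tau>\<bar> \<le> B"
proof -
  have "\<bar>(y(k := \<tau>)) k\<bar> \<le> B"
  proof (rule part_int_support[OF _ nz k(1)])
    fix x assume "cell_ind d f S x \<noteq> 0"
    then have "x \<in> cell d f S" by (auto simp: indicator_def split: if_splits)
    then show "\<bar>x k\<bar> \<le> B" using lattice_simplex_bounded[of d f S x k B] S k b by blast
  qed
  then show ?thesis by simp
qed

text \<open>The facets contribute a constant slope to the shifted sum, and periodicity forces it to vanish.\<close>

lemma line_sum_const_step:
  assumes S: "lattice_simplex (Suc d) f S" and k: "k < d"
    and N: "\<And>s. s \<in> S \<Longrightarrow> \<bar>s k\<bar> \<le> of_int N - 1"
    and IH: "\<And>s. s \<in> S \<Longrightarrow> \<exists>C. \<forall>\<sigma>\<in>{0<..<1}.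
        line_sum N k (part_int (Suc k) d (cell_ind d (facet_family d s f) (S - {s}))) y \<sigma> = C"
    and \<sigma>: "\<sigma> \<in> {0..1}"
  shows "line_sum N k (part_int (Suc k) (Suc d) (cell_ind (Suc d) f S)) y \<sigma>
    = line_sum N k (part_int (Suc k) (Suc d) (cell_ind (Suc d) f S)) y 0"
proof -
  let ?G = "part_int (Suc k) (Suc d) (cell_ind (Suc d) f S)"
  let ?F = "\<lambda>s. part_int (Suc k) d (cell_ind d (facet_family d s f) (S - {s}))"
  define H where "H = (\<lambda>x. \<Sum>s\<in>S. facet_weight k d (f s) * ?F s x)"
  have fin: "finite S" using S by (rule lattice_simplex_finite)
  have boxH: "box_fun (Suc k) H"
    unfolding H_def using k
    by (intro box_fun_lincomb fin box_fun_part_int box_fun_cell lattice_simplex_facet[OF S]) auto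
  from IH obtain C where C: "\<And>s \<sigma>. s \<in> S \<Longrightarrow> \<sigma> \<in> {0<..<1} \<Longrightarrow> line_sum N k (?F s) y \<sigma> = C s"
    by metis
  define c where "c = (\<Sum>s\<in>S. facet_weight k d (f s) * C s)"
  have sumH: "line_sum N k H y \<sigma> = c" if "\<sigma> \<in> {0<..<1}" for \<sigma>
  proof -
    have "line_sum N k H y \<sigma> = (\<Sum>s\<in>S. facet_weight k d (f s) * line_sum N k (?F s) y \<sigma>)"
      unfolding line_sum_def H_def sum_distrib_left by (rule sum.swap)
    then show ?thesis using C that by (simp add: c_def)
  qed
  have *: "line_sum N k ?G y \<sigma> - line_sum N k ?G y 0 = c * \<sigma>" if \<sigma>: "\<sigma> \<in> {0..1}" for \<sigma>
  proof -
    have "line_sum N k ?G y \<sigma> - line_sum N k ?G y 0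
        = (\<Sum>t\<in>{-N..N}. \<integral>\<tau>. indicator {of_int t..of_int t + \<sigma>} \<tau> * H (y(k := \<tau>)) \<partial>lborel)"
      unfolding line_sum_def sum_subtractf[symmetric] H_def
      using \<sigma> by (intro sum.cong refl) (simp add: part_int_cell_diff[OF S k])
    also have "\<dots> = (\<Sum>t\<in>{-N..N}. \<integral>\<tau>. indicator {0..\<sigma>} \<tau> * H (y(k := of_int t + \<tau>)) \<partial>lborel)"
      by (simp add: integral_interval_shift)
    also have "\<dots> = (\<integral>\<tau>. (\<Sum>t\<in>{-N..N}. indicator {0..\<sigma>} \<tau> * H (y(k := of_int t + \<tau>))) \<partial>lborel)"
      by (intro Bochner_Integration.integral_sum[symmetric] integrable_indicator_line[OF boxH])
        (auto simp: emeasure_lborel_Icc_eq)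
    also have "\<dots> = (\<integral>\<tau>. indicator {0..\<sigma>} \<tau> * c \<partial>lborel)"
    proof (rule integral_cong_AE)
      show "(\<lambda>\<tau>. \<Sum>t\<in>{-N..N}. indicator {0..\<sigma>} \<tau> * H (y(k := of_int t + \<tau>))) \<in> borel_measurable lborel"
        by (intro borel_measurable_sum borel_measurable_integrable integrable_indicator_line[OF boxH])
          (auto simp: emeasure_lborel_Icc_eq)
      \<comment> \<open>The facet sums are known to be constant on the open interval only; its two
        endpoints form a null set.\<close>
      have "AE \<tau> in lborel. \<tau> \<noteq> (0::real)" "AE \<tau> in lborel. \<tau> \<noteq> (1::real)"
        by (rule AE_lborel_singleton)+
      then show "AE \<tau> in lborel. (\<Sum>t\<in>{-N..N}. indicator {0..\<sigma>} \<tau> * H (y(k := of_int t + \<tau>))) = indicator {0..\<sigma>} \<tau> * c"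
      proof eventually_elim
        case (elim \<tau>)
        then show ?case
          using sumH[of \<tau>] \<sigma> by (auto simp: indicator_def line_sum_def)
      qed
    qed simp
    also have "\<dots> = c * \<sigma>" using \<sigma> by simp
    finally show ?thesis .
  qed
  have "S \<noteq> {}" using S by (auto simp: lattice_simplex_def)
  then have "0 \<le> N" using N by (fastforce simp: abs_le_iff)
  moreover have "\<bar>\<tau>\<bar> \<le> of_int N - 1" if "?G (y(k := \<tau>)) \<noteq> 0" for \<tau>
    using part_int_cell_support[where B="of_int N - 1" and k=k, OF S _ _ _ that] k N by simp
  ultimately have "line_sum N k ?G y 1 = line_sum N k ?G y 0"
    by (intro line_sum_periodic) auto
  with *[of 1] have "c = 0" by simp
  with *[OF \<sigma>] show ?thesis by simp
qed

text \<open>Over integers y the heights are integers, and comparing \<open>t + \<sigma>\<close> with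
  an integer does not depend on \<open>\<sigma>\<close> as long as 0 < \<open>\<sigma>\<close> < 1.
  The predicate \<open>Q\<close> is the comparison with \<open>\<sigma>\<close> eliminated.\<close>

lemma line_sum_const_base:
  assumes S: "lattice_simplex (Suc d) f S" and y: "\<And>i. i < d \<Longrightarrow> y i \<in> \<int>"
  shows "\<exists>C. \<forall>\<sigma>\<in>{0<..<1}. line_sum N d (cell_ind (Suc d) f S) y \<sigma> = C"
proof -
  define Q where "Q = (\<lambda>t::int. \<forall>s\<in>S. if 0 < snd (f s) d then height d (f s) y \<le> of_int t else of_int t + 1 \<le> height d (f s) y)"
  have "y(d := of_int t + \<sigma>) \<in> cell (Suc d) f S \<longleftrightarrow> Q t" if "\<sigma> \<in> {0<..<1}" for t \<sigma>
  proof -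
    have "0 \<le> snd (f s) d * (of_int t + \<sigma> - height d (f s) y) \<longleftrightarrow>
        (if 0 < snd (f s) d then height d (f s) y \<le> of_int t else of_int t + 1 \<le> height d (f s) y)" if s: "s \<in> S" for s
    proof -
      obtain h where h: "height d (f s) y = of_int h"
        using lattice_simplex_height_int[of d f S s y] S s y by (auto elim: Ints_cases)
      have "of_int h \<le> of_int t + \<sigma> \<longleftrightarrow> h \<le> t" "of_int t + \<sigma> \<le> of_int h \<longleftrightarrow> t + 1 \<le> h"
        using \<open>\<sigma> \<in> {0<..<1}\<close> by auto
      then show ?thesis
        using lattice_simplex_slope[OF S s] unfolding h by (auto simp: zero_le_mult_iff)
    qed
    then show ?thesis
      unfolding cell_upd_iff[OF S] Q_def by blast
  qed
  then have "\<forall>\<sigma>\<in>{0<..<1}. line_sum N d (cell_ind (Suc d) f S) y \<sigma> = (\<Sum>t\<in>{-N..N}. of_bool (Q t))"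
    by (auto simp: line_sum_def indicator_def intro!: sum.cong)
  then show ?thesis by blast
qed

text \<open>Descends through projected facets with k fixed until k is the last coordinate, where no
  integral is left and integrality of heights takes over. The bound N passes to the facets because
  their vertices are taken from S.\<close>

lemma line_sum_const:
  assumes "lattice_simplex (Suc d) f S" "k \<le> d" "\<And>s. s \<in> S \<Longrightarrow> \<bar>s k\<bar> \<le> of_int N - 1" "\<And>i. i < k \<Longrightarrow> y i \<in> \<int>"
  shows "\<exists>C. \<forall>\<sigma>\<in>{0<..<1}. line_sum N k (part_int (Suc k) (Suc d) (cell_ind (Suc d) f S)) y \<sigma> = C"
  using assms
proof (induction d arbitrary: f S)
  case 0
  have "part_int (Suc k) (Suc 0) (cell_ind (Suc 0) f S) = cell_ind (Suc 0) f S"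
    using 0 by (intro ext) simp
  with 0 show ?case using line_sum_const_base[of 0 f S y N] by simp
next
  case (Suc d)
  show ?case
  proof (cases "k = Suc d")
    case True
    have "part_int (Suc k) (Suc (Suc d)) (cell_ind (Suc (Suc d)) f S) = cell_ind (Suc (Suc d)) f S"
      using True by (intro ext) simp
    with True Suc.prems show ?thesis using line_sum_const_base[of "Suc d" f S y N] by simp
  next
    case False
    then have "k < Suc d" "k \<le> d" using Suc.prems by auto
    have "\<exists>C. \<forall>\<sigma>\<in>{0<..<1}.
        line_sum N k (part_int (Suc k) (Suc d) (cell_ind (Suc d) (facet_family (Suc d) s f) (S - {s}))) y \<sigma> = C"
      if "s \<in> S" for s
      using Suc.prems \<open>k \<le> d\<close> that by (intro Suc.IH lattice_simplex_facet) auto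
    then have "\<forall>\<sigma>\<in>{0<..<1}. line_sum N k (part_int (Suc k) (Suc (Suc d)) (cell_ind (Suc (Suc d)) f S)) y \<sigma>
        = line_sum N k (part_int (Suc k) (Suc (Suc d)) (cell_ind (Suc (Suc d)) f S)) y 0"
      using Suc.prems \<open>k < Suc d\<close> by (intro ballI line_sum_const_step) auto
    then show ?thesis by blast
  qed
qed

text \<open>The integral over the line is the mean of the shifted sums over a unit interval. Since k
  < d there is at least one integration inside, so these sums are constant up to and including
  \<open>\<sigma>\<close> = 0.\<close>

lemma line_sum_eq_part_int:
  assumes S: "lattice_simplex (Suc d) f S" and k: "k < d"
    and N: "\<And>s. s \<in> S \<Longrightarrow> \<bar>s k\<bar> \<le> of_int N - 1" and y: "\<And>i. i < k \<Longrightarrow> y i \<in> \<int>"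
  shows "line_sum N k (part_int (Suc k) (Suc d) (cell_ind (Suc d) f S)) y 0
    = part_int k (Suc d) (cell_ind (Suc d) f S) y"
proof -
  let ?G = "part_int (Suc k) (Suc d) (cell_ind (Suc d) f S)"
  obtain e where e: "d = Suc e" using k by (cases d) auto
  have const: "line_sum N k ?G y \<sigma> = line_sum N k ?G y 0" if "\<sigma> \<in> {0..1}" for \<sigma>
    using S k N
  proof (rule line_sum_const_step)
    show "\<sigma> \<in> {0..1}" by (rule that)
    fix s assume "s \<in> S"
    then show "\<exists>C. \<forall>\<sigma>\<in>{0<..<1}.
        line_sum N k (part_int (Suc k) d (cell_ind d (facet_family d s f) (S - {s}))) y \<sigma> = C"
      using lattice_simplex_facet[OF S] N y k unfolding e by (intro line_sum_const) auto
  qed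
  have boxG: "box_fun (Suc k) ?G"
    using k by (intro box_fun_part_int box_fun_cell[OF S]) auto
  \<comment> \<open>Cuts the line into the intervals [t, t + 1); the only nonzero summand is the one
    at the floor of \<open>\<tau>\<close>, which lies within the cutoff.\<close>
  have split: "?G (y(k := \<tau>)) = (\<Sum>t\<in>{-N..N}. indicator {of_int t..<of_int t + 1} \<tau> * ?G (y(k := \<tau>)))" for \<tau>
  proof (cases "?G (y(k := \<tau>)) = 0")
    case False
    then have "\<bar>\<tau>\<bar> \<le> of_int N - 1"
      using part_int_cell_support[where B="of_int N - 1" and k=k, OF S _ _ _ False] k N by simp
    then have fl: "\<lfloor>\<tau>\<rfloor> \<in> {-N..N}"
      by (auto simp: abs_le_iff le_floor_iff floor_le_iff)
    have "(indicator {of_int t..<of_int t + 1} \<tau> :: real) = (if t = \<lfloor>\<tau>\<rfloor> then 1 else 0)" for t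
      using floor_eq_iff[of \<tau> t] by (auto simp: indicator_def)
    then have "(\<Sum>t\<in>{-N..N}. indicator {of_int t..<of_int t + 1} \<tau> * ?G (y(k := \<tau>)))
        = (\<Sum>t\<in>{-N..N}. if t = \<lfloor>\<tau>\<rfloor> then ?G (y(k := \<tau>)) else 0)"
      by (intro sum.cong) auto
    also have "\<dots> = ?G (y(k := \<tau>))"
      using fl by (subst sum.delta) auto
    finally show ?thesis by simp
  qed simp
  have "part_int k (Suc d) (cell_ind (Suc d) f S) y = (\<integral>\<tau>. ?G (y(k := \<tau>)) \<partial>lborel)"
    using k by (intro part_int_outer box_fun_cell[OF S]) auto
  also have "\<dots> = (\<integral>\<tau>. (\<Sum>t\<in>{-N..N}. indicator {of_int t..<of_int t + 1} \<tau> * ?G (y(k := \<tau>))) \<partial>lborel)"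
    using split by (intro Bochner_Integration.integral_cong) auto
  also have "\<dots> = (\<Sum>t\<in>{-N..N}. \<integral>\<tau>. indicator {of_int t..<of_int t + 1} \<tau> * ?G (y(k := \<tau>)) \<partial>lborel)"
    using integrable_indicator_line[OF boxG, where t=0]
    by (intro Bochner_Integration.integral_sum) (simp add: emeasure_lborel_Ico)
  also have "\<dots> = (\<Sum>t\<in>{-N..N}. \<integral>\<tau>. indicator {0..<1} \<tau> * ?G (y(k := of_int t + \<tau>)) \<partial>lborel)"
    by (simp add: integral_interval_shift)
  also have "\<dots> = (\<integral>\<tau>. (\<Sum>t\<in>{-N..N}. indicator {0..<1} \<tau> * ?G (y(k := of_int t + \<tau>))) \<partial>lborel)"
    using integrable_indicator_line[OF boxG]
    by (intro Bochner_Integration.integral_sum[symmetric]) (simp add: emeasure_lborel_Ico)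
  also have "\<dots> = (\<integral>\<tau>. indicator {0..<1::real} \<tau> * line_sum N k ?G y 0 \<partial>lborel)"
    using const by (intro Bochner_Integration.integral_cong) (auto simp: indicator_def line_sum_def)
  also have "\<dots> = line_sum N k ?G y 0" by simp
  finally show ?thesis by simp
qed

section \<open>From lattice sums to volume\<close>

definition lattice_box :: "nat \<Rightarrow> int \<Rightarrow> point set"
  where "lattice_box k N = {x \<in> Zk k. \<forall>i<k. \<bar>x i\<bar> \<le> of_int N}"

lemma lattice_box_0 [simp]: "lattice_box 0 N = {\<lambda>_. 0}"
  by (auto simp: lattice_box_def Zk_def)

lemma bij_betw_lattice_box_Suc:
  "bij_betw (\<lambda>(y, t). y(k := of_int t)) (lattice_box k N \<times> {-N..N}) (lattice_box (Suc k) N)"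
proof (rule bij_betw_byWitness[where f'="\<lambda>x. (x(k := 0), \<lfloor>x k\<rfloor>)"])
  show "\<forall>a\<in>lattice_box k N \<times> {-N..N}. (\<lambda>x. (x(k := 0), \<lfloor>x k\<rfloor>)) (case a of (y, t) \<Rightarrow> y(k := of_int t)) = a"
    by (auto simp: lattice_box_def Zk_def fun_upd_idem)
  show "\<forall>a'\<in>lattice_box (Suc k) N. (case (a'(k := 0), \<lfloor>a' k\<rfloor>) of (y, t) \<Rightarrow> y(k := of_int t)) = a'"
    by (auto simp: lattice_box_def Zk_def)
  show "(\<lambda>(y, t). y(k := of_int t)) ` (lattice_box k N \<times> {-N..N}) \<subseteq> lattice_box (Suc k) N"
    by (auto simp: lattice_box_def Zk_def less_Suc_eq abs_le_iff simp flip: of_int_minus)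
  show "(\<lambda>x. (x(k := 0), \<lfloor>x k\<rfloor>)) ` lattice_box (Suc k) N \<subseteq> lattice_box k N \<times> {-N..N}"
    by (auto simp: lattice_box_def Zk_def abs_le_iff le_floor_iff floor_le_iff)
qed

lemma finite_lattice_box: "finite (lattice_box k N)"
proof (induction k)
  case (Suc k)
  then show ?case using bij_betw_finite[OF bij_betw_lattice_box_Suc, of k N] by simp
qed simp

lemma sum_lattice_box_Suc:
  "(\<Sum>x\<in>lattice_box (Suc k) N. g x) = (\<Sum>y\<in>lattice_box k N. line_sum N k g y 0)"
  unfolding line_sum_def
  by (subst sum.reindex_bij_betw[OF bij_betw_lattice_box_Suc, symmetric])
    (simp add: sum.cartesian_product split_beta)

text \<open>Each induction step trades the sum over coordinate k for an integral. At k = d the left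
  side is the sum of the fibre lengths over lattice points, at k = 0 it is the volume.\<close>

lemma lattice_sum_eq_volume:
  assumes S: "lattice_simplex (Suc d) f S" and N: "\<And>s i. s \<in> S \<Longrightarrow> i \<le> d \<Longrightarrow> \<bar>s i\<bar> \<le> of_int N - 1"
    and "k \<le> d"
  shows "(\<Sum>y\<in>lattice_box k N. part_int k (Suc d) (cell_ind (Suc d) f S) y)
    = part_int 0 (Suc d) (cell_ind (Suc d) f S) (\<lambda>_. 0)"
  using \<open>k \<le> d\<close>
proof (induction k)
  case (Suc k)
  have "(\<Sum>y\<in>lattice_box (Suc k) N. part_int (Suc k) (Suc d) (cell_ind (Suc d) f S) y)
      = (\<Sum>y\<in>lattice_box k N. part_int k (Suc d) (cell_ind (Suc d) f S) y)"
    unfolding sum_lattice_box_Suc using Suc.prems N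
    by (intro sum.cong refl line_sum_eq_part_int[OF S]) (auto simp: lattice_box_def Zk_def)
  with Suc show ?case by simp
qed simp

section \<open>Regular triangulations\<close>

lemma sum_fun_apply: "(\<Sum>a\<in>A. f a) x = (\<Sum>a\<in>A. f a x :: 'b::comm_monoid_add)"
  by (induction A rule: infinite_finite_induct) auto

lemma combination_apply: "(\<Sum>s\<in>S. u s *\<^sub>R s) i = (\<Sum>s\<in>S. u s * s i :: real)"
  by (simp add: sum_fun_apply scaleR_fun_def)

lemma Rk_combination: "S \<subseteq> Rk d \<Longrightarrow> (\<Sum>s\<in>S. u s *\<^sub>R s) \<in> Rk d"
  by (auto simp: Rk_def combination_apply intro!: sum.neutral)

lemma Rk_eqI: "x \<in> Rk d \<Longrightarrow> y \<in> Rk d \<Longrightarrow> (\<And>i. i < d \<Longrightarrow> x i = y i) \<Longrightarrow> x = y"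
  by (rule ext) (metis (mono_tags, lifting) Rk_def mem_Collect_eq not_less)

lemma subspace_Rk: "subspace (Rk d)"
  by (auto simp: subspace_def Rk_def scaleR_fun_def)

definition unit_vec :: "nat \<Rightarrow> nat \<Rightarrow> real"
  where "unit_vec i = (\<lambda>j. if j = i then 1 else 0)"

lemma inj_unit_vec: "inj unit_vec"
  by (rule injI) (metis unit_vec_def zero_neq_one)

lemma unit_vec_combination:
  "(\<Sum>i<d. x i *\<^sub>R unit_vec i) = (\<lambda>j. if j < d then x j else (0::real))"
proof
  fix j
  have "(\<Sum>i<d. x i *\<^sub>R unit_vec i) j = (\<Sum>i<d. if i = j then x i else 0)"
    unfolding sum_fun_apply by (intro sum.cong) (auto simp: scaleR_fun_def unit_vec_def)
  also have "\<dots> = (if j < d then x j else 0)"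
    by (simp add: sum.delta)
  finally show "(\<Sum>i<d. x i *\<^sub>R unit_vec i) j = (if j < d then x j else 0)" .
qed

lemma span_unit_vec: "span (unit_vec ` {..<d}) = Rk d"
proof
  show "span (unit_vec ` {..<d}) \<subseteq> Rk d"
    by (rule span_minimal[OF _ subspace_Rk]) (auto simp: unit_vec_def Rk_def)
  show "Rk d \<subseteq> span (unit_vec ` {..<d})"
  proof
    fix x assume "x \<in> Rk d"
    then have "x = (\<Sum>i<d. x i *\<^sub>R unit_vec i)"
      unfolding unit_vec_combination by (auto simp: Rk_def)
    also have "\<dots> \<in> span (unit_vec ` {..<d})"
      by (intro span_sum span_scale span_base) auto
    finally show "x \<in> span (unit_vec ` {..<d})" .
  qed
qed

lemma independent_unit_vec: "independent (unit_vec ` {..<d})"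
proof (rule independent_if_scalars_zero)
  fix f v assume 0: "(\<Sum>x\<in>unit_vec ` {..<d}. f x *\<^sub>R x) = 0" and "v \<in> unit_vec ` {..<d}"
  then obtain j where j: "j < d" "v = unit_vec j" by auto
  have "(\<Sum>i<d. f (unit_vec i) *\<^sub>R unit_vec i) = 0"
    using 0 by (subst (asm) sum.reindex) (auto intro: inj_on_subset[OF inj_unit_vec])
  then have "(\<lambda>j. if j < d then f (unit_vec j) else 0) = 0"
    unfolding unit_vec_combination[of "\<lambda>i. f (unit_vec i)"] .
  from fun_cong[OF this, of j] j show "f v = 0" by simp
qed simp

lemma card_unit_vec: "card (unit_vec ` {..<d}) = d"
  by (simp add: card_image inj_on_subset[OF inj_unit_vec])

text \<open>The ambient space is infinite-dimensional, so dimension is counted inside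
  \<open>Rk d\<close>: translate a point of S to the origin and compare with the basis
  \<open>unit_vec\<close>.\<close>

lemma affine_independent_Rk_card:
  assumes "\<not> affine_dependent S" "S \<subseteq> Rk d"
  shows "finite S" "card S \<le> Suc d" "affine hull S = Rk d \<Longrightarrow> card S = Suc d"
proof -
  have "finite S \<and> card S \<le> Suc d \<and> (affine hull S = Rk d \<longrightarrow> card S = Suc d)"
  proof (cases "S = {}")
    case True
    moreover have "(0 :: nat \<Rightarrow> real) \<in> Rk d" by (simp add: Rk_def)
    ultimately show ?thesis by auto
  next
    case False
    then obtain a where a: "a \<in> S" by auto
    let ?B = "(\<lambda>x. - a + x) ` (S - {a})"
    have ind: "independent ?B"
      using assms(1) affine_dependent_iff_dependent2[OF a] by simp
    have "?B \<subseteq> Rk d"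
      using a assms(2) subspace_diff[OF subspace_Rk[of d]] by auto
    then have "?B \<subseteq> span (unit_vec ` {..<d})"
      by (simp add: span_unit_vec)
    from independent_span_bound[OF _ ind this] have B: "finite ?B" "card ?B \<le> d"
      by (auto simp: card_unit_vec)
    have inj: "inj_on (\<lambda>x. - a + x) (S - {a})" by (auto simp: inj_on_def)
    have fin: "finite S"
      using B(1) finite_image_iff[OF inj] by simp
    have cB: "card ?B = card S - 1"
      using card_image[OF inj] a fin by simp
    have "card S > 0" using a fin by (auto simp: card_gt_0_iff)
    moreover have "d \<le> card ?B" if hull: "affine hull S = Rk d"
    proof -
      have "unit_vec ` {..<d} \<subseteq> span ?B"
      proof clarify
        fix i assume "i < d"
        then have "a + unit_vec i \<in> Rk d"
          using a assms(2) by (auto simp: Rk_def unit_vec_def subset_iff)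
        then have "a + unit_vec i \<in> (\<lambda>x. a + x) ` span ?B"
          using affine_hull_span2[OF a] hull by simp
        then show "unit_vec i \<in> span ?B" by auto
      qed
      from independent_span_bound[OF B(1) independent_unit_vec this] show ?thesis
        by (simp add: card_unit_vec)
    qed
    ultimately show ?thesis using fin B cB by auto
  qed
  then show "finite S" "card S \<le> Suc d" "affine hull S = Rk d \<Longrightarrow> card S = Suc d" by auto
qed

text \<open>An affine basis contained in S already has d + 1 elements, so it is all of S.\<close>

lemma affine_spanning_independent:
  assumes "S \<subseteq> Rk d" "card S = Suc d" "affine hull S = Rk d"
  shows "\<not> affine_dependent S"
proof -
  obtain B where B: "B \<subseteq> S" "\<not> affine_dependent B" "affine hull B = affine hull S"
    using affine_basis_exists[of S] by metis
  then have "card B = Suc d"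
    using affine_independent_Rk_card(3)[of B d] assms by auto
  then have "B = S"
    using B(1) assms(2) by (intro card_subset_eq) (auto simp: card_ge_0_finite)
  with B show ?thesis by simp
qed

lemma affine_independent_coeffs:
  assumes "finite S" "\<not> affine_dependent S" "S \<subseteq> Rk d"
    and "(\<Sum>s\<in>S. u s) = (\<Sum>s\<in>S. v s)" "\<And>i. i < d \<Longrightarrow> (\<Sum>s\<in>S. u s * s i) = (\<Sum>s\<in>S. v s * s i)" "s \<in> S"
  shows "u s = v s"
proof -
  have "(\<Sum>s\<in>S. (u s - v s) *\<^sub>R s) = 0"
  proof (rule Rk_eqI)
    show "(\<Sum>s\<in>S. (u s - v s) *\<^sub>R s) \<in> Rk d" by (rule Rk_combination[OF assms(3)])
    show "0 \<in> Rk d" by (simp add: Rk_def)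
    show "(\<Sum>s\<in>S. (u s - v s) *\<^sub>R s) i = 0 i" if "i < d" for i
      using assms(5)[OF that] by (simp add: combination_apply left_diff_distrib sum_subtractf)
  qed
  moreover have "(\<Sum>s\<in>S. u s - v s) = 0"
    using assms(4) by (simp add: sum_subtractf)
  ultimately have "\<forall>s\<in>S. u s - v s = 0"
    using assms(1,2) unfolding affine_dependent_explicit_finite[OF assms(1)] by blast
  then show ?thesis using assms(6) by auto
qed

lemma barycentric_exists:
  assumes "finite S" "affine hull S = Rk d"
  shows "\<exists>f. barycentric d f S"
proof -
  have coeffs: "\<exists>u. sum u S = 1 \<and> (\<Sum>v\<in>S. u v *\<^sub>R v) = x" if "x \<in> Rk d" for x
    using that assms(2) unfolding affine_hull_finite[OF assms(1)] by auto
  have "(0 :: nat \<Rightarrow> real) \<in> Rk d" by (simp add: Rk_def)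
  from coeffs[OF this] obtain \<kappa> where \<kappa>: "sum \<kappa> S = 1" "(\<Sum>v\<in>S. \<kappa> v *\<^sub>R v) = 0" by blast
  have "\<exists>u. sum u S = 1 \<and> (\<Sum>v\<in>S. u v *\<^sub>R v) = unit_vec i" if "i < d" for i
    using that by (intro coeffs) (auto simp: Rk_def unit_vec_def)
  then obtain \<rho> where \<rho>: "\<And>i. i < d \<Longrightarrow> sum (\<rho> i) S = 1" "\<And>i. i < d \<Longrightarrow> (\<Sum>v\<in>S. \<rho> i v *\<^sub>R v) = unit_vec i"
    by metis
  \<comment> \<open>The affine functional with value \<open>\<kappa> s\<close> at the origin and
    \<open>\<rho> i s\<close> at \<open>unit_vec i\<close>.\<close>
  define f where "f = (\<lambda>s. (\<kappa> s, \<lambda>i. \<rho> i s - \<kappa> s))"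
  have expand: "(\<Sum>s\<in>S. aff_val d (f s) x * h s)
      = (\<Sum>s\<in>S. \<kappa> s * h s) + (\<Sum>i<d. x i * ((\<Sum>s\<in>S. \<rho> i s * h s) - (\<Sum>s\<in>S. \<kappa> s * h s)))" for x h
  proof -
    have "(\<Sum>s\<in>S. aff_val d (f s) x * h s) = (\<Sum>s\<in>S. \<kappa> s * h s + (\<Sum>i<d. x i * (\<rho> i s * h s - \<kappa> s * h s)))"
      by (intro sum.cong refl) (simp add: aff_val_def f_def sum_distrib_left algebra_simps)
    also have "\<dots> = (\<Sum>s\<in>S. \<kappa> s * h s) + (\<Sum>i<d. \<Sum>s\<in>S. x i * (\<rho> i s * h s - \<kappa> s * h s))"
      unfolding sum.distrib by (subst sum.swap) simp
    finally show ?thesis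
      by (simp add: sum_distrib_left sum_subtractf right_diff_distrib)
  qed
  have "(\<Sum>s\<in>S. aff_val d (f s) x) = 1" for x
    using expand[of x "\<lambda>_. 1"] \<kappa>(1) \<rho>(1) by simp
  moreover have "(\<Sum>s\<in>S. aff_val d (f s) x * s j) = x j" if "j < d" for x j
  proof -
    have k0: "(\<Sum>s\<in>S. \<kappa> s * s j) = 0"
      using fun_cong[OF \<kappa>(2), of j] by (simp add: combination_apply)
    have "(\<Sum>s\<in>S. \<rho> i s * s j) = (if i = j then 1 else 0)" if "i < d" for i
      using fun_cong[OF \<rho>(2)[OF that], of j] by (simp add: combination_apply unit_vec_def)
    then have "(\<Sum>i<d. x i * (\<Sum>s\<in>S. \<rho> i s * s j)) = (\<Sum>i<d. if i = j then x i else 0)"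
      by (intro sum.cong) auto
    then have "(\<Sum>s\<in>S. aff_val d (f s) x * s j) = (\<Sum>i<d. if i = j then x i else 0)"
      by (simp add: expand[of x "\<lambda>s. s j"] k0)
    then show ?thesis using that by (simp add: sum.delta)
  qed
  ultimately show ?thesis unfolding barycentric_def by blast
qed

text \<open>The pivot rule of the simplex method: u w / c w is the largest multiple of c that can be
  subtracted from u while keeping it nonnegative, and the entry at w drops to 0.\<close>

lemma ratio_test:
  fixes u c :: "'a \<Rightarrow> real"
  assumes "finite T" "\<And>t. t \<in> T \<Longrightarrow> 0 \<le> u t" "\<exists>t\<in>T. 0 < c t"
  obtains w where "w \<in> T" "0 < c w" "\<And>t. t \<in> T \<Longrightarrow> u w / c w * c t \<le> u t"
proof -
  let ?P = "{t\<in>T. 0 < c t}"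
  have "finite ?P" "?P \<noteq> {}" using assms by auto
  then obtain w where w: "w \<in> ?P" "\<And>t. t \<in> ?P \<Longrightarrow> u w / c w \<le> u t / c t"
    using ex_is_arg_min_if_finite[of ?P "\<lambda>t. u t / c t"] by (auto simp: is_arg_min_linorder)
  have "u w / c w * c t \<le> u t" if "t \<in> T" for t
  proof (cases "0 < c t")
    case True
    then show ?thesis using w(2)[of t] that by (simp add: field_simps)
  next
    case False
    have "0 \<le> u w / c w" using w(1) assms(2) by simp
    then have "u w / c w * c t \<le> 0" using False by (intro mult_nonneg_nonpos) auto
    also have "0 \<le> u t" using assms(2) that by simp
    finally show ?thesis .
  qed
  with w(1) show thesis by (intro that) auto
qed

text \<open>Caratheodory's argument: in a smallest T, an affine relation among its points could be
  subtracted from the weights until one of them vanishes, which would make T smaller.\<close>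

lemma convex_hull_affine_independent_subset:
  fixes V :: "'a::real_vector set"
  assumes "finite V" "x \<in> convex hull V"
  obtains T where "T \<subseteq> V" "\<not> affine_dependent T" "x \<in> convex hull T"
proof -
  let ?Q = "\<lambda>T. T \<subseteq> V \<and> x \<in> convex hull T"
  obtain T where Q: "?Q T" and min: "\<And>U. ?Q U \<Longrightarrow> card T \<le> card U"
    using ex_has_least_nat[of ?Q V card] assms by auto
  have fin: "finite T" using Q assms(1) finite_subset by blast
  obtain u where u: "\<And>t. t \<in> T \<Longrightarrow> 0 \<le> u t" "sum u T = 1" "(\<Sum>t\<in>T. u t *\<^sub>R t) = x"
    using Q unfolding convex_hull_finite[OF fin] by auto
  have "\<not> affine_dependent T"
  proof
    assume "affine_dependent T"
    then obtain c where c: "sum c T = 0" "\<exists>v\<in>T. c v \<noteq> 0" "(\<Sum>v\<in>T. c v *\<^sub>R v) = 0"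
      unfolding affine_dependent_explicit_finite[OF fin] by auto
    have "\<exists>t\<in>T. 0 < c t"
    proof (rule ccontr)
      assume "\<not> ?thesis"
      then have le: "\<forall>t\<in>T. c t \<le> 0" by (auto simp: not_less)
      then have "\<forall>t\<in>T. - c t = 0"
        using c(1) fin by (subst sum_nonneg_eq_0_iff[symmetric]) (auto simp: sum_negf)
      with c(2) show False by auto
    qed
    then obtain w where w: "w \<in> T" "0 < c w" "\<And>t. t \<in> T \<Longrightarrow> u w / c w * c t \<le> u t"
      using ratio_test[of T u c] fin u(1) by auto
    define q where "q = u w / c w"
    let ?u = "\<lambda>t. u t - q * c t"
    have w0: "?u w = 0" using w by (simp add: q_def)
    have "(\<Sum>t\<in>T. ?u t) = 1" "(\<Sum>t\<in>T. ?u t *\<^sub>R t) = x"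
      using c u by (simp_all add: sum_subtractf sum_distrib_left[symmetric] scaleR_left_diff_distrib
        scaleR_scaleR[symmetric] scaleR_sum_right[symmetric] del: scaleR_scaleR)
    then have "(\<Sum>t\<in>T - {w}. ?u t) = 1" "(\<Sum>t\<in>T - {w}. ?u t *\<^sub>R t) = x"
      using w0 by (simp_all add: sum.remove[OF fin w(1)])
    then have "x \<in> convex hull (T - {w})"
      using w(3) unfolding convex_hull_finite[OF finite_Diff[OF fin]]
      by (auto simp: q_def intro!: exI[of _ ?u])
    then have "card T \<le> card (T - {w})"
      using Q by (intro min) auto
    then show False using fin w(1) by (metis card_Diff1_less leD)
  qed
  with Q show thesis by (intro that) auto
qed

section \<open>Simplices on a finite spanning set and generic points\<close>

definition aff_basis :: "nat \<Rightarrow> point set \<Rightarrow> point set \<Rightarrow> bool"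
  where "aff_basis d V S \<longleftrightarrow> S \<subseteq> V \<and> \<not> affine_dependent S \<and> affine hull S = Rk d"

lemma aff_val_combination:
  assumes "finite U" "(\<Sum>u\<in>U. c u) = 1" "\<And>i. i < d \<Longrightarrow> x i = (\<Sum>u\<in>U. c u * u i)"
  shows "aff_val d g x = (\<Sum>u\<in>U. c u * aff_val d g u)"
proof -
  have "(\<Sum>u\<in>U. c u * aff_val d g u) = (\<Sum>u\<in>U. c u) * fst g + (\<Sum>u\<in>U. \<Sum>i<d. c u * (snd g i * u i))"
    by (simp add: aff_val_def distrib_left sum.distrib sum_distrib_right sum_distrib_left)
  also have "(\<Sum>u\<in>U. \<Sum>i<d. c u * (snd g i * u i)) = (\<Sum>i<d. snd g i * (\<Sum>u\<in>U. c u * u i))"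
    by (subst sum.swap) (simp add: sum_distrib_left mult_ac)
  finally show ?thesis using assms(2,3) by (simp add: aff_val_def)
qed

locale affine_spanning_set =
  fixes d :: nat and V :: "point set" and F :: "point set \<Rightarrow> point \<Rightarrow> aff_fun"
  assumes finV: "finite V" and VRk: "V \<subseteq> Rk d" and hullV: "affine hull V = Rk d"
    and bary: "\<And>S. aff_basis d V S \<Longrightarrow> barycentric d (F S) S"
begin

lemma basis_props:
  assumes "aff_basis d V S"
  shows "finite S" "card S = Suc d" "S \<subseteq> V" "S \<subseteq> Rk d" "\<not> affine_dependent S"
  using assms VRk affine_independent_Rk_card[of S d] by (auto simp: aff_basis_def)

lemma finite_bases: "finite {S. aff_basis d V S}"
  by (rule finite_subset[of _ "Pow V"]) (use finV in \<open>auto simp: aff_basis_def\<close>)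

lemma basis_coeffs:
  assumes S: "aff_basis d V S" and "(\<Sum>s\<in>S. c s) = 1" "\<And>i. i < d \<Longrightarrow> x i = (\<Sum>s\<in>S. c s * s i)" "s \<in> S"
  shows "aff_val d (F S s) x = c s"
  by (rule affine_independent_coeffs[of S d "\<lambda>s. aff_val d (F S s) x" c])
    (use basis_props[OF S] assms barycentric_sum[OF bary[OF S]] barycentric_coord[OF bary[OF S]] in auto)

lemma basis_hull_eq_cell:
  assumes S: "aff_basis d V S"
  shows "convex hull S = cell d (F S) S \<inter> Rk d"
proof (intro equalityI subsetI)
  fix x assume "x \<in> convex hull S"
  then obtain u where u: "\<And>s. s \<in> S \<Longrightarrow> 0 \<le> u s" "sum u S = 1" "(\<Sum>s\<in>S. u s *\<^sub>R s) = x"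
    unfolding convex_hull_finite[OF basis_props(1)[OF S]] by auto
  have "aff_val d (F S s) x = u s" if "s \<in> S" for s
    using basis_coeffs[OF S u(2) _ that] u(3) combination_apply[of u S] by metis
  moreover have "x \<in> Rk d"
    using Rk_combination[OF basis_props(4)[OF S], of u] u(3) by simp
  ultimately show "x \<in> cell d (F S) S \<inter> Rk d"
    using u(1) by (simp add: cell_def)
next
  fix x assume x: "x \<in> cell d (F S) S \<inter> Rk d"
  have "(\<Sum>s\<in>S. aff_val d (F S s) x *\<^sub>R s) = x"
    by (rule Rk_eqI[of _ d])
      (use x basis_props[OF S] barycentric_coord[OF bary[OF S]] in \<open>auto simp: Rk_combination combination_apply\<close>)
  then show "x \<in> convex hull S"
    using x barycentric_sum[OF bary[OF S]] unfolding convex_hull_finite[OF basis_props(1)[OF S]]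
    by (auto simp: cell_def intro!: exI[of _ "\<lambda>s. aff_val d (F S s) x"])
qed

lemma extend_to_basis:
  assumes "T \<subseteq> V" "\<not> affine_dependent T"
  obtains S where "aff_basis d V S" "T \<subseteq> S"
  using extend_to_affine_basis[OF assms(2,1)] hullV unfolding aff_basis_def by metis

lemma in_hull_basis:
  assumes "x \<in> convex hull V"
  obtains S where "aff_basis d V S" "x \<in> convex hull S"
proof -
  obtain T where T: "T \<subseteq> V" "\<not> affine_dependent T" "x \<in> convex hull T"
    using convex_hull_affine_independent_subset[OF finV assms] .
  obtain S where "aff_basis d V S" "T \<subseteq> S"
    using extend_to_basis[OF T(1,2)] .
  with T(3) hull_mono[of T S convex] show thesis by (intro that[of S]) auto
qed

text \<open>Off the hulls of at most d vertices a point lies on no proper face of a simplex, so a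
  triangulation can be asked to cover it exactly once.\<close>

definition generic :: "point \<Rightarrow> bool"
  where "generic x \<longleftrightarrow> (\<forall>U\<subseteq>V. card U \<le> d \<longrightarrow> x \<notin> convex hull U)"

lemma generic_positive:
  assumes "generic x" and S: "aff_basis d V S" and "x \<in> convex hull S" "s \<in> S"
  shows "0 < aff_val d (F S s) x"
proof (rule ccontr)
  assume neg: "\<not> ?thesis"
  have x: "x \<in> cell d (F S) S" "x \<in> Rk d"
    using assms(3) basis_hull_eq_cell[OF S] by auto
  with neg assms(4) have 0: "aff_val d (F S s) x = 0" by (force simp: cell_def)
  note fin = basis_props(1)[OF S]
  have "(\<Sum>s\<in>S. aff_val d (F S s) x *\<^sub>R s) = x"
    by (rule Rk_eqI[of _ d])
      (use x basis_props[OF S] barycentric_coord[OF bary[OF S]] in \<open>auto simp: Rk_combination combination_apply\<close>)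
  then have "(\<Sum>s\<in>S - {s}. aff_val d (F S s) x *\<^sub>R s) = x" "(\<Sum>s\<in>S - {s}. aff_val d (F S s) x) = 1"
    using 0 barycentric_sum[OF bary[OF S], of x] by (simp_all add: sum.remove[OF fin assms(4)])
  then have "x \<in> convex hull (S - {s})"
    using x unfolding convex_hull_finite[OF finite_Diff[OF fin]]
    by (auto simp: cell_def intro!: exI[of _ "\<lambda>s. aff_val d (F S s) x"])
  moreover have "S - {s} \<subseteq> V" "card (S - {s}) \<le> d"
    using basis_props[OF S] assms(4) by auto
  ultimately show False using assms(1) by (auto simp: generic_def)
qed

text \<open>An affinely independent part of T whose hull still contains x has more than d points by
  genericity, so it is T; extending it to a basis adds nothing.\<close>

lemma generic_basis:
  assumes "generic x" "T \<subseteq> V" "card T = Suc d" "x \<in> convex hull T"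
  shows "aff_basis d V T"
proof -
  have fin: "finite T" using assms(2) finV finite_subset by blast
  obtain T' where T': "T' \<subseteq> T" "\<not> affine_dependent T'" "x \<in> convex hull T'"
    using convex_hull_affine_independent_subset[OF fin assms(4)] .
  obtain S where S: "aff_basis d V S" "T' \<subseteq> S"
    using extend_to_basis[of T'] T' assms(2) by blast
  have "\<not> card T' \<le> d"
    using assms(1,2) T' by (auto simp: generic_def)
  then have "T' = T" "T' = S"
    using T' S assms(3) fin basis_props[OF S(1)] card_seteq[of T T'] card_seteq[of S T'] by auto
  with S show ?thesis by simp
qed

text \<open>The affine function that agrees with \<open>\<omega>\<close> on S: the hyperplane
  through the lifted vertices of the simplex.\<close>

definition lift :: "(point \<Rightarrow> real) \<Rightarrow> point set \<Rightarrow> point \<Rightarrow> real"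
  where "lift \<omega> S x = (\<Sum>s\<in>S. aff_val d (F S s) x * \<omega> s)"

lemma lift_combination:
  assumes "finite U" "(\<Sum>u\<in>U. c u) = 1" "\<And>i. i < d \<Longrightarrow> x i = (\<Sum>u\<in>U. c u * u i)"
  shows "lift \<omega> S x = (\<Sum>u\<in>U. c u * lift \<omega> S u)"
proof -
  have "lift \<omega> S x = (\<Sum>s\<in>S. (\<Sum>u\<in>U. c u * aff_val d (F S s) u) * \<omega> s)"
    unfolding lift_def by (intro sum.cong refl) (simp add: aff_val_combination[OF assms])
  also have "\<dots> = (\<Sum>u\<in>U. c u * lift \<omega> S u)"
    unfolding lift_def sum_distrib_left sum_distrib_right by (subst sum.swap) (simp add: mult.assoc)
  finally show ?thesis .
qed

lemma lift_vertex:
  assumes "aff_basis d V S" "v \<in> S"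
  shows "lift \<omega> S v = \<omega> v"
proof -
  note fin = basis_props(1)[OF assms(1)]
  have "aff_val d (F S s) v = (if s = v then 1 else 0)" if "s \<in> S" for s
    using assms fin that by (intro basis_coeffs) (auto simp: if_distrib[of "\<lambda>x. x * _"] sum.delta cong: if_cong)
  then have "lift \<omega> S v = (\<Sum>s\<in>S. if s = v then \<omega> s else 0)"
    unfolding lift_def by (intro sum.cong) auto
  then show ?thesis using assms fin by (simp add: sum.delta)
qed

text \<open>With heights \<open>M ^ idx v\<close>, equality of \<open>lift\<close> and height is a
  polynomial equation in M whose coefficient at \<open>idx v\<close> is 1. Finitely many pairs
  exclude finitely many M.\<close>

lemma generic_heights:
  obtains \<omega> :: "(nat \<Rightarrow> real) \<Rightarrow> real" where "\<And>S v. aff_basis d V S \<Longrightarrow> v \<in> V - S \<Longrightarrow> lift \<omega> S v \<noteq> \<omega> v"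
proof -
  obtain idx :: "(nat \<Rightarrow> real) \<Rightarrow> nat" where idx: "inj_on idx V"
    using finite_imp_inj_to_nat_seg[OF finV] by blast
  define p where "p = (\<lambda>(S, v). monom 1 (idx v) - (\<Sum>s\<in>S. monom (aff_val d (F S s) v) (idx s)))"
  define A where "A = (SIGMA S : {S. aff_basis d V S}. V - S)"
  have "finite A"
    unfolding A_def using finV finite_bases by auto
  have nz: "p a \<noteq> 0" if aA: "a \<in> A" for a
  proof -
    obtain S v where a: "a = (S, v)" "aff_basis d V S" "v \<in> V" "v \<notin> S"
      using aA by (cases a) (auto simp: A_def)
    have "idx s \<noteq> idx v" if "s \<in> S" for s
      using a that basis_props(3)[OF a(2)] inj_onD[OF idx, of s v] by auto
    then have "coeff (p a) (idx v) = 1"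
      by (simp add: p_def a coeff_sum)
    then show ?thesis by auto
  qed
  have "finite (\<Union>a\<in>A. {M. poly (p a) M = 0})"
    using \<open>finite A\<close> nz by (auto intro: poly_roots_finite)
  then obtain M :: real where M: "M \<notin> (\<Union>a\<in>A. {M. poly (p a) M = 0})"
    using ex_new_if_finite[OF infinite_UNIV_char_0] by blast
  show thesis
  proof (rule that[of "\<lambda>v. M ^ idx v"])
    fix S v assume "aff_basis d V S" "v \<in> V - S"
    then have "poly (p (S, v)) M \<noteq> 0"
      using M by (auto simp: A_def)
    then show "lift (\<lambda>v. M ^ idx v) S v \<noteq> M ^ idx v"
      by (simp add: p_def lift_def poly_monom poly_sum)
  qed
qed

text \<open>A regular triangulation: keep the simplices whose lift lies strictly below every other lifted point.\<close>

lemma triangulation: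
  obtains \<T> where "\<T> \<subseteq> {S. aff_basis d V S}"
    "\<And>x. generic x \<Longrightarrow> x \<in> convex hull V \<Longrightarrow> \<exists>!S. S \<in> \<T> \<and> x \<in> convex hull S"
proof -
  obtain \<omega> :: "(nat \<Rightarrow> real) \<Rightarrow> real" where \<omega>: "\<And>S v. aff_basis d V S \<Longrightarrow> v \<in> V - S \<Longrightarrow> lift \<omega> S v \<noteq> \<omega> v"
    by (rule generic_heights) blast
  define \<T> where "\<T> = {S. aff_basis d V S \<and> (\<forall>v\<in>V - S. lift \<omega> S v < \<omega> v)}"
  \<comment> \<open>Evaluates \<open>lift \<omega> S\<close> with the weights of x in
    \<open>S'\<close>: it is at most \<open>\<omega>\<close> on the vertices of \<open>S'\<close>,
    strictly below at one outside S, and genericity makes all weights positive.\<close>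
  have less: "lift \<omega> S x < lift \<omega> S' x"
    if x: "generic x" "x \<in> convex hull S'" and S: "S \<in> \<T>" "S' \<in> \<T>" and "\<not> S' \<subseteq> S" for x S S'
  proof -
    have bS: "aff_basis d V S" "aff_basis d V S'" using S by (auto simp: \<T>_def)
    let ?c = "\<lambda>u. aff_val d (F S' u) x"
    note fin = basis_props(1)[OF bS(2)]
    have "lift \<omega> S x = (\<Sum>u\<in>S'. ?c u * lift \<omega> S u)"
      using barycentric_sum[OF bary[OF bS(2)]] barycentric_coord[OF bary[OF bS(2)]]
      by (intro lift_combination fin) auto
    also have "\<dots> < (\<Sum>u\<in>S'. ?c u * \<omega> u)"
    proof (rule sum_strict_mono_ex1[OF fin])
      show "\<forall>u\<in>S'. ?c u * lift \<omega> S u \<le> ?c u * \<omega> u"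
      proof
        fix u assume u: "u \<in> S'"
        have "lift \<omega> S u \<le> \<omega> u"
          using lift_vertex[OF bS(1), of u] S(1) u basis_props(3)[OF bS(2)] by (cases "u \<in> S") (auto simp: \<T>_def intro: less_imp_le)
        then show "?c u * lift \<omega> S u \<le> ?c u * \<omega> u"
          using generic_positive[OF x(1) bS(2) x(2) u] by simp
      qed
      obtain u where u: "u \<in> S'" "u \<notin> S" using \<open>\<not> S' \<subseteq> S\<close> by auto
      then have "lift \<omega> S u < \<omega> u"
        using S(1) basis_props(3)[OF bS(2)] by (auto simp: \<T>_def)
      then show "\<exists>u\<in>S'. ?c u * lift \<omega> S u < ?c u * \<omega> u"
        using generic_positive[OF x(1) bS(2) x(2) u(1)] u(1) by (intro bexI[of _ u]) auto
    qed
    finally show ?thesis by (simp add: lift_def)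
  qed
  have unique: "S = S'" if x: "generic x" "x \<in> convex hull S" "x \<in> convex hull S'" and S: "S \<in> \<T>" "S' \<in> \<T>" for x S S'
  proof (rule ccontr)
    assume "S \<noteq> S'"
    have bS: "aff_basis d V S" "aff_basis d V S'" using S by (auto simp: \<T>_def)
    have "\<not> S \<subseteq> S'" "\<not> S' \<subseteq> S"
      using \<open>S \<noteq> S'\<close> basis_props(1,2)[OF bS(1)] basis_props(1,2)[OF bS(2)] card_subset_eq by metis+
    then show False
      using less[OF x(1,3) S] less[OF x(1,2) S(2,1)] by simp
  qed
  \<comment> \<open>Among the simplices containing x, one with the lowest lift at x lies on the
    lower hull. If some v were lifted below its hyperplane, pivoting v in would give a lower simplex
    containing x.\<close>
  have ex: "\<exists>S. S \<in> \<T> \<and> x \<in> convex hull S" if x: "generic x" "x \<in> convex hull V" for x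
  proof -
    let ?Q = "{S. aff_basis d V S \<and> x \<in> convex hull S}"
    have "finite ?Q" using finite_bases by simp
    moreover have "?Q \<noteq> {}" using in_hull_basis[OF x(2)] by auto
    ultimately obtain S where S: "aff_basis d V S" "x \<in> convex hull S"
      and min: "\<And>S'. aff_basis d V S' \<Longrightarrow> x \<in> convex hull S' \<Longrightarrow> lift \<omega> S x \<le> lift \<omega> S' x"
      using ex_is_arg_min_if_finite[of ?Q "\<lambda>S. lift \<omega> S x"] by (auto simp: is_arg_min_linorder)
    note fin = basis_props(1)[OF S(1)]
    let ?l = "\<lambda>s. aff_val d (F S s) x"
    have pos: "0 < ?l s" if "s \<in> S" for s
      using generic_positive[OF x(1) S that] .
    have "lift \<omega> S v < \<omega> v" if v: "v \<in> V - S" for v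
    proof (rule ccontr)
      assume "\<not> ?thesis"
      with \<omega>[OF S(1) v] have gt: "\<omega> v < lift \<omega> S v" by simp
      let ?b = "\<lambda>s. aff_val d (F S s) v"
      have "\<exists>s\<in>S. 0 < ?b s"
      proof (rule ccontr)
        assume "\<not> ?thesis"
        then have "(\<Sum>s\<in>S. ?b s) \<le> 0" by (intro sum_nonpos) (auto simp: not_less)
        then show False using barycentric_sum[OF bary[OF S(1)], of v] by simp
      qed
      then obtain w where w: "w \<in> S" "0 < ?b w" "\<And>t. t \<in> S \<Longrightarrow> ?l w / ?b w * ?b t \<le> ?l t"
        using ratio_test[of S ?l ?b] fin pos less_imp_le by metis
      define \<theta> where "\<theta> = ?l w / ?b w"
      have "0 < \<theta>" using w pos[OF w(1)] by (simp add: \<theta>_def)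
      define S' where "S' = insert v (S - {w})"
      \<comment> \<open>New weights of x: add \<open>\<theta>\<close> times v and subtract
        \<open>\<theta>\<close> times its expression in S. The ratio test chose
        \<open>\<theta>\<close> so that w leaves with weight 0 and no other weight turns
        negative.\<close>
      define c where "c = (\<lambda>s. if s = v then \<theta> else ?l s - \<theta> * ?b s)"
      have zero: "?l w - \<theta> * ?b w = 0" using w(2) by (simp add: \<theta>_def)
      have sumS': "(\<Sum>s\<in>S'. c s * h s) = (\<Sum>s\<in>S. ?l s * h s) + \<theta> * (h v - (\<Sum>s\<in>S. ?b s * h s))" for h
      proof -
        have "(\<Sum>s\<in>S'. c s * h s) = \<theta> * h v + (\<Sum>s\<in>S - {w}. c s * h s)"
          unfolding S'_def using fin v by (subst sum.insert) (auto simp: c_def)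
        also have "(\<Sum>s\<in>S - {w}. c s * h s) = (\<Sum>s\<in>S - {w}. (?l s - \<theta> * ?b s) * h s)"
          using v by (intro sum.cong) (auto simp: c_def)
        also have "\<dots> = (\<Sum>s\<in>S. (?l s - \<theta> * ?b s) * h s)"
          using zero by (simp add: sum.remove[OF fin w(1)])
        also have "\<dots> = (\<Sum>s\<in>S. ?l s * h s) - \<theta> * (\<Sum>s\<in>S. ?b s * h s)"
          by (simp add: left_diff_distrib sum_subtractf sum_distrib_left mult.assoc)
        finally show ?thesis by (simp add: algebra_simps)
      qed
      have c1: "(\<Sum>s\<in>S'. c s) = 1"
        using sumS'[of "\<lambda>_. 1"] barycentric_sum[OF bary[OF S(1)]] by simp
      have ci: "x i = (\<Sum>s\<in>S'. c s * s i)" if "i < d" for i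
        using sumS'[of "\<lambda>s. s i"] barycentric_coord[OF bary[OF S(1)] that] by simp
      have S'V: "S' \<subseteq> V" "finite S'" "card S' = Suc d"
        using v basis_props[OF S(1)] w(1) by (auto simp: S'_def)
      have "x \<in> Rk d" using S(2) basis_hull_eq_cell[OF S(1)] by auto
      then have "(\<Sum>s\<in>S'. c s *\<^sub>R s) = x"
        using S'V VRk ci by (intro Rk_eqI[of _ d] Rk_combination) (auto simp: combination_apply)
      moreover have "\<forall>s\<in>S'. 0 \<le> c s"
        using w(3) \<open>0 < \<theta>\<close> by (auto simp: c_def S'_def \<theta>_def)
      ultimately have xS': "x \<in> convex hull S'"
        unfolding convex_hull_finite[OF S'V(2)] using c1 by (auto intro!: exI[of _ c])
      have bS': "aff_basis d V S'"
        using generic_basis[OF x(1) S'V(1,3) xS'] .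
      have "lift \<omega> S' x = (\<Sum>s\<in>S'. c s * \<omega> s)"
        unfolding lift_def using basis_coeffs[OF bS' c1 ci] by (intro sum.cong) auto
      also have "\<dots> = lift \<omega> S x + \<theta> * (\<omega> v - lift \<omega> S v)"
        using sumS'[of \<omega>] by (simp add: lift_def)
      also have "\<dots> < lift \<omega> S x"
        using gt \<open>0 < \<theta>\<close> by (simp add: mult_pos_neg)
      finally show False using min[OF bS' xS'] by simp
    qed
    then show ?thesis using S by (auto simp: \<T>_def)
  qed
  show thesis
  proof (rule that[of \<T>])
    show "\<T> \<subseteq> {S. aff_basis d V S}" by (auto simp: \<T>_def)
    show "\<exists>!S. S \<in> \<T> \<and> x \<in> convex hull S" if "generic x" "x \<in> convex hull V" for x
      using ex[OF that] unique[OF that(1)] by blast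
  qed
qed

end

section \<open>Vertices of lattice-face polytopes\<close>

text \<open>In a smallest generating subset U no point lies in the hull of the others, so all its
  points are extreme.\<close>

lemma polytope_vertices:
  assumes "finite W" "P = convex hull W"
  shows "vertices P \<subseteq> W" "P = convex hull (vertices P)"
proof -
  show sub: "vertices P \<subseteq> W"
    using extreme_point_of_convex_hull assms(2) by (auto simp: vertices_def)
  obtain U where U: "U \<subseteq> W" "convex hull U = P" and min: "\<And>U'. U' \<subseteq> W \<and> convex hull U' = P \<Longrightarrow> card U \<le> card U'"
    using ex_has_least_nat[of "\<lambda>U. U \<subseteq> W \<and> convex hull U = P" W card] assms(2) by auto
  have fin: "finite U" using U(1) assms(1) finite_subset by blast
  have "x \<in> vertices P" if x: "x \<in> U" for x
  proof -
    have "x \<notin> convex hull (U - {x})"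
    proof
      assume "x \<in> convex hull (U - {x})"
      then have "convex hull (U - {x}) = convex hull (insert x (U - {x}))"
        by (rule hull_redundant[symmetric])
      then have "card U \<le> card (U - {x})"
        using U x by (intro min) (auto simp: insert_absorb)
      then show False using fin x by (metis card_Diff1_less leD)
    qed
    then have "x extreme_point_of (convex hull (insert x (U - {x})))"
      using fin by (intro extreme_point_of_convex_hull_insert) auto
    then show ?thesis
      using x by (simp add: vertices_def U insert_absorb)
  qed
  then have "U \<subseteq> vertices P" by auto
  then have "P \<subseteq> convex hull (vertices P)"
    using U(2) hull_mono[of U "vertices P" convex] by auto
  moreover have "convex hull (vertices P) \<subseteq> P"
    using sub assms(2) hull_mono[of "vertices P" W convex] by auto
  ultimately show "P = convex hull (vertices P)" by auto
qed

lemma affine_hull_Rk [simp]: "affine hull (Rk d) = Rk d"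
  by (intro hull_same subspace_imp_affine subspace_Rk)

lemma affine_hull_pair_Rk:
  assumes "p \<in> Rk (Suc 0)" "q \<in> Rk (Suc 0)" "p \<noteq> q"
  shows "affine hull {p, q} = Rk (Suc 0)"
proof -
  have "\<not> affine_dependent {p, q}" by (rule affine_independent_2)
  then obtain T where T: "\<not> affine_dependent T" "{p, q} \<subseteq> T" "T \<subseteq> Rk (Suc 0)" "affine hull T = affine hull (Rk (Suc 0))"
    using extend_to_affine_basis[of "{p, q}" "Rk (Suc 0)"] assms by auto
  then have "finite T" "card T = Suc (Suc 0)"
    using affine_independent_Rk_card[OF T(1,3)] by auto
  then have "{p, q} = T"
    using T(2) assms(3) by (intro card_seteq) auto
  with T show ?thesis by simp
qed

lemma lattice_face_vertices:
  assumes "lattice_face (Suc d) P"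
  shows "finite (vertices P)" "P = convex hull (vertices P)" "vertices P \<subseteq> Rk (Suc d)"
    "affine hull (vertices P) = Rk (Suc d)"
proof -
  have "\<exists>W. finite W \<and> P = convex hull W \<and> W \<subseteq> Rk (Suc d) \<and> affine hull P = Rk (Suc d)"
  proof (cases d)
    case 0
    then obtain p q where pq: "p \<in> Zk 1" "q \<in> Zk 1" "p \<noteq> q" "P = closed_segment p q"
      using assms by auto
    then have "p \<in> Rk (Suc 0)" "q \<in> Rk (Suc 0)" by (auto simp: Zk_def Rk_def)
    with pq 0 show ?thesis
      by (intro exI[of _ "{p, q}"]) (simp add: segment_convex_hull affine_hull_convex_hull affine_hull_pair_Rk)
  next
    case (Suc e)
    then have P: "polytope P" "P \<subseteq> Rk (Suc d)" "affine hull P = Rk (Suc d)"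
      using assms by (auto simp: d_polytope_def)
    then obtain W where "finite W" "P = convex hull W" by (auto simp: polytope_def)
    moreover from this have "W \<subseteq> P" by (simp add: hull_subset)
    ultimately show ?thesis using P by blast
  qed
  then obtain W where W: "finite W" "P = convex hull W" "W \<subseteq> Rk (Suc d)" "affine hull P = Rk (Suc d)"
    by blast
  note V = polytope_vertices[OF W(1,2)]
  show "finite (vertices P)" "vertices P \<subseteq> Rk (Suc d)"
    using V(1) W finite_subset by auto
  show "P = convex hull (vertices P)" by (rule V(2))
  show "affine hull (vertices P) = Rk (Suc d)"
    using W(4) V(2) affine_hull_convex_hull[of "vertices P"] by simp
qed

lemma affine_spanning_card:
  assumes "finite V" "V \<subseteq> Rk d" "affine hull V = Rk d"
  shows "Suc d \<le> card V"
proof -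
  obtain B where B: "B \<subseteq> V" "\<not> affine_dependent B" "affine hull B = affine hull V"
    using affine_basis_exists[of V] by metis
  then have "card B = Suc d"
    using assms affine_independent_Rk_card(3)[of B d] by auto
  then show ?thesis using B(1) assms(1) card_mono by metis
qed

lemma extend_subset_card:
  assumes "finite V" "W \<subseteq> V" "card W \<le> n" "n \<le> card V"
  obtains U where "W \<subseteq> U" "U \<subseteq> V" "card U = n"
  using exists_subset_between[OF assms(3,4,2,1)] by blast

section \<open>From the recursive definition to \<open>lattice_general\<close>\<close>

lemma linear_proj: "linear (proj k)"
  by (rule linearI) (auto simp: proj_def scaleR_fun_def fun_eq_iff)

text \<open>A counting argument: the projected hull spans \<open>Rk (Suc e)\<close> and so has at
  least e + 2 vertices, all among the images of the e + 2 points of U. Hence these images are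
  distinct, all vertices, and affinely independent.\<close>

lemma lattice_face_facet:
  assumes P: "lattice_face (Suc (Suc e)) P" and U: "U \<subseteq> vertices P" "card U = Suc (Suc e)"
  defines "\<pi> \<equiv> proj (Suc (Suc e))"
  shows "lattice_face (Suc e) (\<pi> ` (convex hull U))" "vertices (\<pi> ` (convex hull U)) = \<pi> ` U"
    "inj_on \<pi> U" "\<not> affine_dependent (\<pi> ` U)" "\<pi> ` U \<subseteq> Rk (Suc e)"
proof -
  show lf: "lattice_face (Suc e) (\<pi> ` (convex hull U))"
    using P U by (simp add: \<pi>_def)
  have finU: "finite U" using U(2) card_ge_0_finite by force
  have hull: "\<pi> ` (convex hull U) = convex hull (\<pi> ` U)"
    unfolding \<pi>_def by (rule convex_hull_linear_image[OF linear_proj])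
  let ?V = "vertices (\<pi> ` (convex hull U))"
  note V = lattice_face_vertices[OF lf]
  have sub: "?V \<subseteq> \<pi> ` U"
    using polytope_vertices(1)[of "\<pi> ` U"] finU hull by simp
  have "Suc (Suc e) \<le> card ?V"
    using V by (intro affine_spanning_card) auto
  moreover have "card (\<pi> ` U) \<le> Suc (Suc e)"
    using card_image_le[OF finU, of \<pi>] U(2) by simp
  ultimately show eq: "?V = \<pi> ` U"
    using sub finU by (intro card_seteq) auto
  have card: "card (\<pi> ` U) = card U"
    using \<open>Suc (Suc e) \<le> card ?V\<close> \<open>card (\<pi> ` U) \<le> Suc (Suc e)\<close> eq U(2) by simp
  then show "inj_on \<pi> U" by (rule eq_card_imp_inj_on[OF finU])
  show "\<pi> ` U \<subseteq> Rk (Suc e)" using V(3) eq by simp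
  show "\<not> affine_dependent (\<pi> ` U)"
    using V eq card U(2) by (intro affine_spanning_independent[of _ "Suc e"]) auto
qed

lemma proj_sum:
  assumes "inj_on (proj (Suc k)) U" "W \<subseteq> U"
  shows "(\<Sum>w\<in>proj (Suc k) ` W. c (the_inv_into U (proj (Suc k)) w)) = (\<Sum>w\<in>W. c w)"
    and "i < k \<Longrightarrow> (\<Sum>w\<in>proj (Suc k) ` W. c (the_inv_into U (proj (Suc k)) w) * w i) = (\<Sum>w\<in>W. c w * w i)"
proof -
  have inv: "the_inv_into U (proj (Suc k)) (proj (Suc k) w) = w" if "w \<in> W" for w
    using assms that by (auto intro: the_inv_into_f_f)
  have inj: "inj_on (proj (Suc k)) W" using assms by (rule inj_on_subset)
  show "(\<Sum>w\<in>proj (Suc k) ` W. c (the_inv_into U (proj (Suc k)) w)) = (\<Sum>w\<in>W. c w)"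
    by (simp add: sum.reindex[OF inj] inv)
  show "(\<Sum>w\<in>proj (Suc k) ` W. c (the_inv_into U (proj (Suc k)) w) * w i) = (\<Sum>w\<in>W. c w * w i)" if "i < k"
    using that by (simp add: sum.reindex[OF inj] inv) (simp add: proj_def)
qed

text \<open>Independence is that of the projected points. For integrality, condition (b) provides a
  lattice point of the affine span of U over the given integers; by independence its weights are c,
  so its last coordinate is the sum in question.\<close>

lemma lattice_face_hyperplane:
  assumes P: "lattice_face (Suc (Suc e)) P" and U: "U \<subseteq> vertices P" "card U = Suc (Suc e)"
  shows "(\<Sum>w\<in>U. c w) = 0 \<Longrightarrow> (\<And>i. i < Suc e \<Longrightarrow> (\<Sum>w\<in>U. c w * w i) = 0) \<Longrightarrow> w \<in> U \<Longrightarrow> c w = 0"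
    and "(\<Sum>w\<in>U. c w) = 1 \<Longrightarrow> (\<And>i. i < Suc e \<Longrightarrow> (\<Sum>w\<in>U. c w * w i) \<in> \<int>) \<Longrightarrow>
      (\<Sum>w\<in>U. c w * w (Suc e)) \<in> \<int>"
proof -
  let ?\<pi> = "proj (Suc (Suc e))"
  note facet = lattice_face_facet[OF P U]
  have finU: "finite U" using U(2) card_ge_0_finite by force
  have indep: "c w = c' w" if "(\<Sum>w\<in>U. c w) = (\<Sum>w\<in>U. c' w)"
    "\<And>i. i < Suc e \<Longrightarrow> (\<Sum>w\<in>U. c w * w i) = (\<Sum>w\<in>U. c' w * w i)" "w \<in> U" for c c' w
  proof -
    have "c (the_inv_into U ?\<pi> (?\<pi> w)) = c' (the_inv_into U ?\<pi> (?\<pi> w))"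
      by (rule affine_independent_coeffs[OF finite_imageI[OF finU] facet(4,5)])
        (use that proj_sum[OF facet(3) order_refl] in auto)
    then show ?thesis using the_inv_into_f_f[OF facet(3)] that(3) by simp
  qed
  show "(\<Sum>w\<in>U. c w) = 0 \<Longrightarrow> (\<And>i. i < Suc e \<Longrightarrow> (\<Sum>w\<in>U. c w * w i) = 0) \<Longrightarrow> w \<in> U \<Longrightarrow> c w = 0"
    using indep[of c "\<lambda>_. 0" w] by simp
  assume c1: "(\<Sum>w\<in>U. c w) = 1" and ci: "\<And>i. i < Suc e \<Longrightarrow> (\<Sum>w\<in>U. c w * w i) \<in> \<int>"
  define y where "y = (\<lambda>i. if i < Suc e then (\<Sum>w\<in>U. c w * w i) else 0)"
  have "y \<in> Zk (Suc e)" using ci by (simp add: y_def Zk_def)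
  also have "Zk (Suc e) = ?\<pi> ` (affine hull U \<inter> Zk (Suc (Suc e)))"
    using P U by simp
  finally obtain z where z: "z \<in> affine hull U" "z \<in> Zk (Suc (Suc e))" "y = ?\<pi> z"
    by blast
  obtain c' where c': "sum c' U = 1" "(\<Sum>w\<in>U. c' w *\<^sub>R w) = z"
    using z(1) unfolding affine_hull_finite[OF finU] by auto
  have zi: "z i = (\<Sum>w\<in>U. c' w * w i)" for i
    using combination_apply[of c' U i] c'(2) by simp
  have "c w = c' w" if "w \<in> U" for w
  proof (rule indep[OF _ _ that])
    show "(\<Sum>w\<in>U. c w) = (\<Sum>w\<in>U. c' w)" using c1 c' by simp
    show "(\<Sum>w\<in>U. c w * w i) = (\<Sum>w\<in>U. c' w * w i)" if "i < Suc e" for i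
      using fun_cong[OF z(3), of i] that by (simp add: y_def proj_def zi)
  qed
  then have "(\<Sum>w\<in>U. c w * w (Suc e)) = z (Suc e)"
    by (simp add: zi)
  also have "\<dots> \<in> \<int>" using z(2) by (simp add: Zk_def)
  finally show "(\<Sum>w\<in>U. c w * w (Suc e)) \<in> \<int>" .
qed

lemma lattice_generalI:
  assumes "\<And>j W c w. j < d \<Longrightarrow> W \<subseteq> V \<Longrightarrow> card W = Suc j \<Longrightarrow> (\<Sum>w\<in>W. c w) = 0 \<Longrightarrow>
      (\<And>i. i < j \<Longrightarrow> (\<Sum>w\<in>W. c w * w i) = 0) \<Longrightarrow> w \<in> W \<Longrightarrow> c w = 0"
    and "\<And>j W c. j < d \<Longrightarrow> W \<subseteq> V \<Longrightarrow> card W = Suc j \<Longrightarrow> (\<Sum>w\<in>W. c w) = 1 \<Longrightarrow>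
      (\<And>i. i < j \<Longrightarrow> (\<Sum>w\<in>W. c w * w i) \<in> \<int>) \<Longrightarrow> (\<Sum>w\<in>W. c w * w j) \<in> \<int>"
  shows "lattice_general d V"
  unfolding lattice_general_def
proof (intro allI impI conjI ballI)
  fix j W c w
  assume "j < d" "W \<subseteq> V" "card W = Suc j" "sum c W = 0 \<and> (\<forall>i<j. (\<Sum>w\<in>W. c w * w i) = 0)" "w \<in> W"
  then show "c w = 0" using assms(1)[of j W c w] by blast
next
  fix j W c
  assume "j < d" "W \<subseteq> V" "card W = Suc j" "sum c W = 1 \<and> (\<forall>i<j. (\<Sum>w\<in>W. c w * w i) \<in> \<int>)"
  then show "(\<Sum>w\<in>W. c w * w j) \<in> \<int>" using assms(2)[of j W c] by blast
qed

text \<open>For the largest j the set W is itself one of the sets U of the definition. A smaller W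
  is enlarged to such a U, whose projection spans a lattice-face polytope one dimension lower; the
  coordinates that matter for W survive the projection.\<close>

lemma lattice_face_lattice_general:
  "lattice_face (Suc d) P \<Longrightarrow> lattice_general (Suc d) (vertices P)"
proof (induction d arbitrary: P)
  case 0
  then obtain p q where pq: "p \<in> Zk 1" "q \<in> Zk 1" "P = convex hull {p, q}"
    by (auto simp: segment_convex_hull)
  then have V: "vertices P \<subseteq> Zk 1"
    using polytope_vertices(1)[of "{p, q}" P] by auto
  show ?case
  proof (rule lattice_generalI)
    fix j and W :: "(nat \<Rightarrow> real) set" and c :: "(nat \<Rightarrow> real) \<Rightarrow> real" and w
    assume "j < Suc 0" "card W = Suc j" "(\<Sum>w\<in>W. c w) = 0" "w \<in> W"
    then show "c w = 0" by (auto simp: card_1_singleton_iff)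
  next
    fix j and W :: "(nat \<Rightarrow> real) set" and c :: "(nat \<Rightarrow> real) \<Rightarrow> real"
    assume "j < Suc 0" "W \<subseteq> vertices P" "card W = Suc j" "(\<Sum>w\<in>W. c w) = 1"
    then show "(\<Sum>w\<in>W. c w * w j) \<in> \<int>"
      using V by (auto simp: card_1_singleton_iff Zk_def)
  qed
next
  case (Suc e)
  let ?\<pi> = "proj (Suc (Suc e))"
  note P = Suc.prems
  note V = lattice_face_vertices[OF P]
  have cV: "Suc (Suc e) \<le> card (vertices P)"
    using affine_spanning_card[OF V(1,3,4)] by simp
  have lower: "\<exists>U. U \<subseteq> vertices P \<and> card U = Suc (Suc e) \<and> W \<subseteq> U \<and> lattice_general (Suc e) (?\<pi> ` U)"
    if W: "W \<subseteq> vertices P" "card W = Suc j" "j < Suc e" for W j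
  proof -
    obtain U where U: "W \<subseteq> U" "U \<subseteq> vertices P" "card U = Suc (Suc e)"
      using extend_subset_card[of "vertices P" W "Suc (Suc e)"] V(1) cV W by auto
    have "lattice_general (Suc e) (?\<pi> ` U)"
      using Suc.IH[OF lattice_face_facet(1)[OF P U(2,3)]] lattice_face_facet(2)[OF P U(2,3)] by simp
    with U show ?thesis by blast
  qed
  show ?case
  proof (rule lattice_generalI)
    fix j W and c :: "(nat \<Rightarrow> real) \<Rightarrow> real" and w
    assume j: "j < Suc (Suc e)" and W: "W \<subseteq> vertices P" "card W = Suc j" and c0: "(\<Sum>w\<in>W. c w) = 0"
      and ci: "\<And>i. i < j \<Longrightarrow> (\<Sum>w\<in>W. c w * w i) = 0" and w: "w \<in> W"
    show "c w = 0"
    proof (cases "j = Suc e")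
      case True
      then show ?thesis
        using lattice_face_hyperplane(1)[OF P W(1), of c w] W c0 ci w by auto
    next
      case False
      then have j: "j < Suc e" using j by simp
      obtain U where U: "U \<subseteq> vertices P" "card U = Suc (Suc e)" "W \<subseteq> U" and LG: "lattice_general (Suc e) (?\<pi> ` U)"
        using lower[OF W j] by blast
      note inj = lattice_face_facet(3)[OF P U(1,2)]
      have "c (the_inv_into U ?\<pi> (?\<pi> w)) = 0"
      proof (rule lattice_generalD_indep[OF LG j, where W="?\<pi> ` W" and c="\<lambda>w. c (the_inv_into U ?\<pi> w)"])
        show "card (?\<pi> ` W) = Suc j"
          using W(2) card_image[OF inj_on_subset[OF inj U(3)]] by simp
      qed (use U(3) w j c0 ci proj_sum[OF inj U(3)] in auto)
      then show ?thesis using the_inv_into_f_f[OF inj] U(3) w by auto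
    qed
  next
    fix j W and c :: "(nat \<Rightarrow> real) \<Rightarrow> real"
    assume j: "j < Suc (Suc e)" and W: "W \<subseteq> vertices P" "card W = Suc j" and c1: "(\<Sum>w\<in>W. c w) = 1"
      and ci: "\<And>i. i < j \<Longrightarrow> (\<Sum>w\<in>W. c w * w i) \<in> \<int>"
    show "(\<Sum>w\<in>W. c w * w j) \<in> \<int>"
    proof (cases "j = Suc e")
      case True
      then show ?thesis
        using lattice_face_hyperplane(2)[OF P W(1), of c] W c1 ci by auto
    next
      case False
      then have j: "j < Suc e" using j by simp
      obtain U where U: "U \<subseteq> vertices P" "card U = Suc (Suc e)" "W \<subseteq> U" and LG: "lattice_general (Suc e) (?\<pi> ` U)"
        using lower[OF W j] by blast
      note inj = lattice_face_facet(3)[OF P U(1,2)]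
      have "(\<Sum>w\<in>?\<pi> ` W. c (the_inv_into U ?\<pi> w) * w j) \<in> \<int>"
      proof (rule lattice_generalD_int[OF LG j])
        show "card (?\<pi> ` W) = Suc j"
          using W(2) card_image[OF inj_on_subset[OF inj U(3)]] by simp
      qed (use U(3) j c1 ci proj_sum[OF inj U(3)] in auto)
      then show ?thesis using proj_sum(2)[OF inj U(3) j] by simp
    qed
  qed
qed

section \<open>Counting lattice points\<close>

lemma upd_in_Rk_Suc: "y \<in> Rk d \<Longrightarrow> y(d := t) \<in> Rk (Suc d)"
  by (auto simp: Rk_def)

locale lattice_spanning_set = affine_spanning_set "Suc d" V F for d V F +
  assumes general: "lattice_general (Suc d) V"
begin

lemma basis_simplex: "aff_basis (Suc d) V S \<Longrightarrow> lattice_simplex (Suc d) (F S) S"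
  using basis_props[of S] bary[of S] lattice_general_mono[OF general] by (auto simp: lattice_simplex_def)

text \<open>Unlike \<open>convex hull V\<close>, this set does not constrain the coordinates beyond \<open>d\<close>.\<close>

definition cyl :: "point set"
  where "cyl = (\<Union>S\<in>{S. aff_basis (Suc d) V S}. cell (Suc d) (F S) S)"

lemma hull_iff_cyl:
  assumes "x \<in> Rk (Suc d)"
  shows "x \<in> convex hull V \<longleftrightarrow> x \<in> cyl"
proof
  assume "x \<in> convex hull V"
  then obtain S where "aff_basis (Suc d) V S" "x \<in> convex hull S" by (rule in_hull_basis)
  then show "x \<in> cyl" using basis_hull_eq_cell by (auto simp: cyl_def)
next
  assume "x \<in> cyl"
  then obtain S where S: "aff_basis (Suc d) V S" "x \<in> cell (Suc d) (F S) S" by (auto simp: cyl_def)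
  then have "x \<in> convex hull S" using assms basis_hull_eq_cell by auto
  then show "x \<in> convex hull V" using hull_mono[OF basis_props(3)[OF S(1)], of convex] by auto
qed

lemma cyl_bounded:
  assumes "x \<in> cyl" "i < Suc d" "\<And>v. v \<in> V \<Longrightarrow> \<bar>v i\<bar> \<le> B"
  shows "\<bar>x i\<bar> \<le> B"
proof -
  obtain S where S: "aff_basis (Suc d) V S" "x \<in> cell (Suc d) (F S) S"
    using assms(1) by (auto simp: cyl_def)
  show ?thesis
    by (rule cell_bounded[OF bary[OF S(1)] S(2) assms(2)]) (use basis_props(3)[OF S(1)] assms(3) in auto)
qed

lemma box_fun_cyl: "box_fun (Suc d) (indicator cyl)"
proof -
  obtain B where B: "\<And>v i. v \<in> V \<Longrightarrow> i < Suc d \<Longrightarrow> \<bar>v i\<bar> \<le> B"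
    using finite_coords_bounded[OF finV, of "Suc d"] by auto
  have "cyl \<in> sets coord_space"
    unfolding cyl_def using finite_bases by (intro sets.finite_UN cell_measurable) (auto simp: basis_props(1))
  then show ?thesis using cyl_bounded B by (intro box_fun_indicator[of _ _ B]) auto
qed

text \<open>A set of at most d + 1 vertices extends to one of exactly d + 1, which is independent in
  the first d coordinates. Its hull is part of a graph and meets a vertical line at most
  once.\<close>

lemma finite_nongeneric: "finite {t. \<not> generic (y(d := t))}"
proof -
  have single: "t = t'" if U: "U \<subseteq> V" "card U \<le> Suc d" and t: "y(d := t) \<in> convex hull U" "y(d := t') \<in> convex hull U" for U t t'
  proof -
    have "Suc d \<le> card V" using affine_spanning_card[OF finV VRk hullV] by simp
    then obtain W where W: "U \<subseteq> W" "W \<subseteq> V" "card W = Suc d"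
      using extend_subset_card[OF finV U] by blast
    have finW: "finite W" using W(2) finV finite_subset by blast
    have "convex hull U \<subseteq> convex hull W" by (rule hull_mono[OF W(1)])
    with t have "y(d := t) \<in> convex hull W" "y(d := t') \<in> convex hull W" by auto
    then obtain c c' where c: "sum c W = 1" "(\<Sum>w\<in>W. c w *\<^sub>R w) = y(d := t)"
      "sum c' W = 1" "(\<Sum>w\<in>W. c' w *\<^sub>R w) = y(d := t')"
      unfolding convex_hull_finite[OF finW] by auto
    have ci: "(\<Sum>w\<in>W. c w * w i) = (y(d := t)) i" "(\<Sum>w\<in>W. c' w * w i) = (y(d := t')) i" for i
      using combination_apply[of c W i] combination_apply[of c' W i] c by simp_all
    have "c w - c' w = 0" if "w \<in> W" for w
      by (rule lattice_generalD_indep[OF general, of d W "\<lambda>w. c w - c' w"])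
        (use W c ci that in \<open>auto simp: sum_subtractf left_diff_distrib\<close>)
    then have "(\<Sum>w\<in>W. c w * w d) = (\<Sum>w\<in>W. c' w * w d)"
      by (intro sum.cong) auto
    then show ?thesis using ci[of d] by simp
  qed
  have "{t. \<not> generic (y(d := t))} = (\<Union>U\<in>{U \<in> Pow V. card U \<le> Suc d}. {t. y(d := t) \<in> convex hull U})"
    by (auto simp: generic_def)
  moreover have "finite {t. y(d := t) \<in> convex hull U}" if "U \<in> {U \<in> Pow V. card U \<le> Suc d}" for U
  proof (cases "{t. y(d := t) \<in> convex hull U} = {}")
    case False
    then obtain t where "y(d := t) \<in> convex hull U" by auto
    then have "{t. y(d := t) \<in> convex hull U} \<subseteq> {t}"
      using single that by auto
    then show ?thesis using finite_subset by blast
  qed simp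
  ultimately show ?thesis using finV by auto
qed

text \<open>Nongeneric points are finite in number on every vertical line. The identity therefore
  holds for each y, not just almost every y, and may be summed over lattice points.\<close>

lemma fiber_length_triangulation:
  obtains \<T> where "\<T> \<subseteq> {S. aff_basis (Suc d) V S}"
    "\<And>y. y \<in> Rk d \<Longrightarrow> part_int d (Suc d) (indicator cyl) y
      = (\<Sum>S\<in>\<T>. part_int d (Suc d) (cell_ind (Suc d) (F S) S) y)"
proof -
  obtain \<T> where \<T>: "\<T> \<subseteq> {S. aff_basis (Suc d) V S}"
    and uniq: "\<And>x. generic x \<Longrightarrow> x \<in> convex hull V \<Longrightarrow> \<exists>!S. S \<in> \<T> \<and> x \<in> convex hull S"
    by (rule triangulation) blast
  have fin: "finite \<T>" using \<T> finite_bases finite_subset by blast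
  have box: "box_fun (Suc d) (cell_ind (Suc d) (F S) S)" if "S \<in> \<T>" for S
    using \<T> that by (intro box_fun_cell basis_simplex) auto
  have "part_int d (Suc d) (indicator cyl) y = (\<Sum>S\<in>\<T>. part_int d (Suc d) (cell_ind (Suc d) (F S) S) y)"
    if y: "y \<in> Rk d" for y
  proof -
    have eq: "(indicator cyl (y(d := t)) :: real) = (\<Sum>S\<in>\<T>. 1 * cell_ind (Suc d) (F S) S (y(d := t)))"
      if g: "generic (y(d := t))" for t
    proof -
      let ?x = "y(d := t)"
      have x: "?x \<in> Rk (Suc d)" using y by (rule upd_in_Rk_Suc)
      have cell: "cell_ind (Suc d) (F S) S ?x = of_bool (?x \<in> convex hull S)" if "S \<in> \<T>" for S
        using basis_hull_eq_cell[of S] \<T> that x by (auto simp: indicator_def)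
      show ?thesis
      proof (cases "?x \<in> convex hull V")
        case True
        from uniq[OF g True] obtain S where S: "S \<in> \<T>" "?x \<in> convex hull S"
          "\<And>S'. S' \<in> \<T> \<Longrightarrow> ?x \<in> convex hull S' \<Longrightarrow> S' = S" by blast
        have "(\<Sum>S\<in>\<T>. 1 * cell_ind (Suc d) (F S) S ?x) = (\<Sum>S'\<in>\<T>. if S' = S then 1 else 0)"
        proof (rule sum.cong[OF refl])
          fix S' assume S': "S' \<in> \<T>"
          have "?x \<in> convex hull S' \<longleftrightarrow> S' = S"
            using S(2) S(3)[OF S'] by blast
          then show "1 * cell_ind (Suc d) (F S') S' ?x = (if S' = S then 1 else 0)"
            using cell[OF S'] by simp
        qed
        with S(1) fin True hull_iff_cyl[OF x] show ?thesis by (simp add: sum.delta)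
      next
        case False
        have "?x \<notin> convex hull S" if "S \<in> \<T>" for S
          using False hull_mono[of S V convex] basis_props(3)[of S] \<T> that by auto
        then have "(\<Sum>S\<in>\<T>. 1 * cell_ind (Suc d) (F S) S ?x) = 0"
          by (intro sum.neutral) (auto simp: cell)
        with False hull_iff_cyl[OF x] show ?thesis by simp
      qed
    qed
    have "part_int d (Suc d) (indicator cyl) y = (\<integral>t. indicator cyl (y(d := t)) \<partial>lborel)"
      by (rule part_int_single[OF box_fun_cyl])
    also have "\<dots> = (\<integral>t. (\<Sum>S\<in>\<T>. 1 * cell_ind (Suc d) (F S) S (y(d := t))) \<partial>lborel)"
    proof (rule integral_cong_AE)
      show "(\<lambda>t. indicator cyl (y(d := t)) :: real) \<in> borel_measurable lborel"
        using measurable_upd_comp[OF box_funD_measurable[OF box_fun_cyl]] by simp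
      show "(\<lambda>t. \<Sum>S\<in>\<T>. 1 * cell_ind (Suc d) (F S) S (y(d := t))) \<in> borel_measurable lborel"
        using measurable_upd_comp[OF box_funD_measurable[OF box_fun_lincomb[OF fin box, where c="\<lambda>_. 1"]]] by simp
      have "AE t in lborel. t \<notin> {t. \<not> generic (y(d := t))}"
        by (intro AE_not_in finite_imp_null_set_lborel finite_nongeneric)
      then show "AE t in lborel. indicator cyl (y(d := t)) = (\<Sum>S\<in>\<T>. 1 * cell_ind (Suc d) (F S) S (y(d := t)))"
        by (rule AE_mp) (use eq in \<open>auto intro!: AE_I2\<close>)
    qed
    also have "\<dots> = part_int d (Suc d) (\<lambda>x. \<Sum>S\<in>\<T>. 1 * cell_ind (Suc d) (F S) S x) y"
      by (rule part_int_single[OF box_fun_lincomb[OF fin box], symmetric])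
    also have "\<dots> = (\<Sum>S\<in>\<T>. 1 * part_int d (Suc d) (cell_ind (Suc d) (F S) S) y)"
      by (rule part_int_lincomb[OF fin box])
    finally show ?thesis by simp
  qed
  with \<T> show thesis by (intro that) auto
qed

text \<open>The part over y of the lattice points of \<open>Omega\<close>. The lower witness
  \<open>t'\<close> is real, because the negative boundary is defined by all points of the
  fibre.\<close>

definition upper_pts :: "point \<Rightarrow> int set"
  where "upper_pts y = {t. y(d := of_int t) \<in> convex hull V \<and> (\<exists>t'. y(d := t') \<in> convex hull V \<and> t' < of_int t)}"

text \<open>The fibre is compact and convex, hence an interval, and rounding a point down or up
  stays inside, so its ends are integers a and b. Without its lowest point it contains b - a
  integers, which is its length.\<close>

lemma card_upper_pts:
  assumes y: "y \<in> Zk d"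
  shows "finite (upper_pts y)" "real (card (upper_pts y)) = part_int d (Suc d) (indicator cyl) y"
proof -
  have yR: "y \<in> Rk d" and yZ: "\<And>i. i < d \<Longrightarrow> y i \<in> \<int>" using y by (auto simp: Zk_def Rk_def)
  define A where "A = {t. y(d := t) \<in> convex hull V}"
  define C where "C = (\<lambda>S. {t. y(d := t) \<in> cell (Suc d) (F S) S})"
  have inA: "t \<in> A \<longleftrightarrow> y(d := t) \<in> cyl" for t
    using hull_iff_cyl[OF upd_in_Rk_Suc[OF yR]] by (simp add: A_def)
  then have A_eq: "A = (\<Union>S\<in>{S. aff_basis (Suc d) V S}. C S)"
    by (auto simp: cyl_def C_def)
  have len: "part_int d (Suc d) (indicator cyl) y = measure lborel A"
    unfolding part_int_indicator_single[OF box_fun_cyl] using inA by (simp add: A_def set_eq_iff)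
  have C_eq: "C S = (\<Inter>s\<in>S. {t. 0 \<le> snd (F S s) d * (t - height d (F S s) y)})" if "aff_basis (Suc d) V S" for S
    using cell_upd_iff[OF basis_simplex[OF that], of y] by (auto simp: C_def)
  have "closed (C S)" if "aff_basis (Suc d) V S" for S
    unfolding C_eq[OF that] by (intro closed_INT ballI closed_Collect_le continuous_intros)
  then have "closed A"
    unfolding A_eq using finite_bases by (intro closed_UN) auto
  moreover obtain B where B: "\<And>v i. v \<in> V \<Longrightarrow> i < Suc d \<Longrightarrow> \<bar>v i\<bar> \<le> B"
    using finite_coords_bounded[OF finV, of "Suc d"] by auto
  have "\<bar>t\<bar> \<le> B" if "t \<in> A" for t
    using cyl_bounded[of "y(d := t)" d B] B that inA by simp
  then have "bounded A" by (auto simp: bounded_iff)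
  ultimately have "compact A" by (simp add: compact_eq_bounded_closed)
  moreover have "convex A"
  proof (rule convexI)
    fix s t u v :: real assume st: "s \<in> A" "t \<in> A" and uv: "0 \<le> u" "0 \<le> v" "u + v = 1"
    have "y(d := u *\<^sub>R s + v *\<^sub>R t) = u *\<^sub>R (y(d := s)) + v *\<^sub>R (y(d := t))"
      using uv(3) by (auto simp: fun_eq_iff scaleR_fun_def simp flip: distrib_right)
    then show "u *\<^sub>R s + v *\<^sub>R t \<in> A"
      using convexD[OF convex_convex_hull, of "y(d := s)" V "y(d := t)" u v] st uv by (simp add: A_def)
  qed
  then have "connected A" by (rule convex_connected)
  ultimately obtain lo hi where lohi: "A = {lo..hi}"
    using connected_compact_interval_1[of A] by auto
  \<comment> \<open>Within one simplex the constraints have the form t >= h or t <= h with integer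
    h, and both survive rounding in either direction.\<close>
  have round: "of_int \<lfloor>t\<rfloor> \<in> A" "of_int \<lceil>t\<rceil> \<in> A" if t: "t \<in> A" for t
  proof -
    obtain S where S: "aff_basis (Suc d) V S" "t \<in> C S" using t A_eq by auto
    have *: "0 \<le> snd (F S s) d * (of_int \<lfloor>t\<rfloor> - height d (F S s) y) \<and> 0 \<le> snd (F S s) d * (of_int \<lceil>t\<rceil> - height d (F S s) y)"
      if s: "s \<in> S" for s
    proof -
      obtain h where h: "height d (F S s) y = of_int h"
        using lattice_simplex_height_int[of d "F S" S s y] basis_simplex[OF S(1)] s yZ by (auto elim: Ints_cases)
      have "0 \<le> snd (F S s) d * (t - of_int h)" using S s C_eq h by auto
      then show ?thesis unfolding h by (auto simp: zero_le_mult_iff le_floor_iff ceiling_le_iff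
            floor_le_iff le_ceiling_iff)
    qed
    then show "of_int \<lfloor>t\<rfloor> \<in> A" "of_int \<lceil>t\<rceil> \<in> A"
      using S(1) C_eq[OF S(1)] by (auto simp: A_eq)
  qed
  show "finite (upper_pts y)" "real (card (upper_pts y)) = part_int d (Suc d) (indicator cyl) y"
  proof -
    have "finite (upper_pts y) \<and> real (card (upper_pts y)) = measure lborel A"
    proof (cases "lo \<le> hi")
      case False
      then have "A = {}" using lohi by auto
      then show ?thesis by (simp add: upper_pts_def A_def)
    next
      case True
      have "lo = of_int \<lfloor>lo\<rfloor>"
        using round(1)[of lo] True lohi by (auto intro: antisym)
      moreover have "hi = of_int \<lceil>hi\<rceil>"
        using round(2)[of hi] True lohi by (auto intro: antisym)
      ultimately obtain a b :: int where ab: "lo = of_int a" "hi = of_int b" by metis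
      have "upper_pts y = {t. of_int t \<in> A \<and> (\<exists>t'\<in>A. t' < of_int t)}"
        by (auto simp: upper_pts_def A_def)
      also have "\<dots> = {a<..b}"
        using lohi ab True by (auto intro!: bexI[of _ "of_int a"])
      finally have "upper_pts y = {a<..b}" .
      then show ?thesis using True lohi ab by simp
    qed
    then show "finite (upper_pts y)" "real (card (upper_pts y)) = part_int d (Suc d) (indicator cyl) y"
      using len by auto
  qed
qed

lemma Omega_lattice_points:
  "bij_betw (\<lambda>(y, t). y(d := of_int t)) (SIGMA y : Zk d. upper_pts y) (Lat (Suc d) (Omega (Suc d) (convex hull V)))"
proof (rule bij_betw_byWitness[where f'="\<lambda>x. (x(d := 0), \<lfloor>x d\<rfloor>)"])
  show "\<forall>a\<in>SIGMA y : Zk d. upper_pts y. (\<lambda>x. (x(d := 0), \<lfloor>x d\<rfloor>)) (case a of (y, t) \<Rightarrow> y(d := of_int t)) = a"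
    by (auto simp: Zk_def fun_upd_idem)
  show "\<forall>x\<in>Lat (Suc d) (Omega (Suc d) (convex hull V)). (case (x(d := 0), \<lfloor>x d\<rfloor>) of (y, t) \<Rightarrow> y(d := of_int t)) = x"
    by (auto simp: Lat_def Zk_def)
  show "(\<lambda>(y, t). y(d := of_int t)) ` (SIGMA y : Zk d. upper_pts y) \<subseteq> Lat (Suc d) (Omega (Suc d) (convex hull V))"
  proof clarsimp
    fix y t assume y: "y \<in> Zk d" and t: "t \<in> upper_pts y"
    then obtain t' where t': "y(d := of_int t) \<in> convex hull V" "y(d := t') \<in> convex hull V" "t' < of_int t"
      by (auto simp: upper_pts_def)
    then have "y(d := of_int t) \<notin> NB (Suc d) (convex hull V)"
      by (auto simp: NB_def proj_def intro!: bexI[of _ "y(d := t')"])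
    with t' y show "y(d := of_int t) \<in> Lat (Suc d) (Omega (Suc d) (convex hull V))"
      by (auto simp: Lat_def Omega_def Zk_def less_Suc_eq)
  qed
  show "(\<lambda>x. (x(d := 0), \<lfloor>x d\<rfloor>)) ` Lat (Suc d) (Omega (Suc d) (convex hull V)) \<subseteq> (SIGMA y : Zk d. upper_pts y)"
  proof clarify
    fix x assume x: "x \<in> Lat (Suc d) (Omega (Suc d) (convex hull V))"
    then obtain z where z: "z \<in> convex hull V" "z(d := 0) = x(d := 0)" "z d < x d"
      by (auto simp: Lat_def Omega_def NB_def proj_def not_le)
    have xd: "x d = of_int \<lfloor>x d\<rfloor>" using x by (simp add: Lat_def Zk_def)
    have "x(d := z d) = (z(d := 0))(d := z d)" by (simp add: z(2))
    then have "x(d := z d) = z" by simp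
    then have "\<lfloor>x d\<rfloor> \<in> upper_pts (x(d := 0))"
      unfolding upper_pts_def using x z xd by (auto simp: Lat_def Omega_def intro!: exI[of _ "z d"])
    moreover have "x(d := 0) \<in> Zk d" using x by (auto simp: Lat_def Zk_def)
    ultimately show "x(d := 0) \<in> Zk d \<and> \<lfloor>x d\<rfloor> \<in> upper_pts (x(d := 0))" by simp
  qed
qed

text \<open>On \<open>Rk (Suc d)\<close>, restriction to the index range is inverted by gluing into
  the zero point, where \<open>cyl\<close> and the hull agree.\<close>

lemma Vol_hull: "Vol (Suc d) (convex hull V) = part_int 0 (Suc d) (indicator cyl) (\<lambda>_. 0)"
proof -
  let ?D = "Suc d"
  let ?g = "glue 0 ?D (\<lambda>_. 0)"
  have VR: "convex hull V \<subseteq> Rk ?D"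
    using convex_hull_subset_affine_hull[of V] hullV by auto
  have gR: "?g z \<in> Rk ?D" for z by (auto simp: glue_def Rk_def)
  have set_eq: "(\<lambda>x. restrict x {..<?D}) ` (convex hull V) = {z \<in> space (leb 0 ?D). ?g z \<in> cyl}"
  proof (intro equalityI subsetI)
    fix z assume "z \<in> (\<lambda>x. restrict x {..<?D}) ` (convex hull V)"
    then obtain x where x: "x \<in> convex hull V" "z = restrict x {..<?D}" by auto
    then have "?g z = x" using VR by (auto simp: glue_def Rk_def fun_eq_iff)
    moreover have "z \<in> space (leb 0 ?D)" using x(2) by (auto simp: space_PiM)
    ultimately show "z \<in> {z \<in> space (leb 0 ?D). ?g z \<in> cyl}"
      using x(1) hull_iff_cyl gR by (metis (mono_tags, lifting) mem_Collect_eq)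
  next
    fix z assume z: "z \<in> {z \<in> space (leb 0 ?D). ?g z \<in> cyl}"
    then have "?g z \<in> convex hull V" using hull_iff_cyl[OF gR] by simp
    moreover have "z = restrict (?g z) {..<?D}"
      using z by (auto simp: space_PiM PiE_def extensional_def glue_def fun_eq_iff restrict_def)
    ultimately show "z \<in> (\<lambda>x. restrict x {..<?D}) ` (convex hull V)" by auto
  qed
  have "part_int 0 ?D (indicator cyl) (\<lambda>_. 0) = (\<integral>z. indicator {z \<in> space (leb 0 ?D). ?g z \<in> cyl} z \<partial>leb 0 ?D)"
    unfolding part_int_def by (intro Bochner_Integration.integral_cong) (auto simp: indicator_def)
  also have "\<dots> = measure (leb 0 ?D) {z \<in> space (leb 0 ?D). ?g z \<in> cyl}"
    by (simp add: Int_def conj_commute) 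
  finally show ?thesis
    unfolding Vol_def set_eq by (simp add: lessThan_atLeast0)
qed

text \<open>One decomposition of fibre lengths serves twice: summed over lattice points it splits
  the count into simplices, and integrated over the first d coordinates it reassembles their
  volumes.\<close>

lemma card_Omega_eq_Vol: "real (card (Lat (Suc d) (Omega (Suc d) (convex hull V)))) = Vol (Suc d) (convex hull V)"
proof -
  obtain \<T> where \<T>: "\<T> \<subseteq> {S. aff_basis (Suc d) V S}"
    and tri: "\<And>y. y \<in> Rk d \<Longrightarrow> part_int d (Suc d) (indicator cyl) y
      = (\<Sum>S\<in>\<T>. part_int d (Suc d) (cell_ind (Suc d) (F S) S) y)"
    by (rule fiber_length_triangulation) blast
  have fin: "finite \<T>" using \<T> finite_bases finite_subset by blast
  obtain B where B: "\<And>v i. v \<in> V \<Longrightarrow> i < Suc d \<Longrightarrow> \<bar>v i\<bar> \<le> B"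
    using finite_coords_bounded[OF finV, of "Suc d"] by auto
  \<comment> \<open>The summand 1 is the margin that \<open>line_sum\<close> needs for shifts up to
    1.\<close>
  define N where "N = \<lceil>B\<rceil> + 1"
  have BN: "B \<le> of_int N - 1" by (simp add: N_def)
  have empty: "upper_pts y = {}" if "y \<in> Zk d - lattice_box d N" for y
  proof (rule ccontr)
    assume "upper_pts y \<noteq> {}"
    then obtain t where t: "y(d := t) \<in> convex hull V" by (auto simp: upper_pts_def)
    have "y(d := t) \<in> Rk (Suc d)" using that by (intro upd_in_Rk_Suc) (auto simp: Zk_def Rk_def)
    then have "y(d := t) \<in> cyl" using hull_iff_cyl t by simp
    then have "\<bar>y i\<bar> \<le> of_int N" if "i < d" for i
      using cyl_bounded[of "y(d := t)" i B] B BN that by fastforce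
    then show False using that by (auto simp: lattice_box_def)
  qed
  have boxZ: "lattice_box d N \<subseteq> Zk d" by (auto simp: lattice_box_def)
  have ZR: "y \<in> Rk d" if "y \<in> lattice_box d N" for y
    using that by (auto simp: lattice_box_def Zk_def Rk_def)
  have simplex: "lattice_simplex (Suc d) (F S) S" if "S \<in> \<T>" for S
    using \<T> that by (intro basis_simplex) auto
  have "card (Lat (Suc d) (Omega (Suc d) (convex hull V))) = card (SIGMA y : Zk d. upper_pts y)"
    using bij_betw_same_card[OF Omega_lattice_points] by simp
  also have "(SIGMA y : Zk d. upper_pts y) = (SIGMA y : lattice_box d N. upper_pts y)"
    using empty boxZ by blast
  also have "card \<dots> = (\<Sum>y\<in>lattice_box d N. card (upper_pts y))"
    using boxZ by (intro card_SigmaI finite_lattice_box ballI card_upper_pts) auto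
  finally have "real (card (Lat (Suc d) (Omega (Suc d) (convex hull V))))
      = (\<Sum>y\<in>lattice_box d N. part_int d (Suc d) (indicator cyl) y)"
    using boxZ by (simp add: card_upper_pts(2) subset_iff)
  also have "\<dots> = (\<Sum>y\<in>lattice_box d N. \<Sum>S\<in>\<T>. part_int d (Suc d) (cell_ind (Suc d) (F S) S) y)"
    by (intro sum.cong refl tri ZR)
  also have "\<dots> = (\<Sum>S\<in>\<T>. \<Sum>y\<in>lattice_box d N. part_int d (Suc d) (cell_ind (Suc d) (F S) S) y)"
    by (rule sum.swap)
  also have "\<dots> = (\<Sum>S\<in>\<T>. part_int 0 (Suc d) (cell_ind (Suc d) (F S) S) (\<lambda>_. 0))"
  proof (intro sum.cong refl lattice_sum_eq_volume simplex)
    fix S s i assume "S \<in> \<T>" "s \<in> S" "i \<le> d"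
    then have "s \<in> V" using \<T> basis_props(3) by blast
    then show "\<bar>s i\<bar> \<le> of_int N - 1" using B[of s i] BN \<open>i \<le> d\<close> by simp
  qed auto
  also have "\<dots> = (\<Sum>S\<in>\<T>. 1 * part_int 0 d (part_int d (Suc d) (cell_ind (Suc d) (F S) S)) (\<lambda>_. 0))"
    by (simp add: part_int_inner[OF box_fun_cell[OF simplex]])
  also have "\<dots> = part_int 0 d (\<lambda>y. \<Sum>S\<in>\<T>. 1 * part_int d (Suc d) (cell_ind (Suc d) (F S) S) y) (\<lambda>_. 0)"
    by (intro part_int_lincomb[symmetric] fin box_fun_part_int box_fun_cell simplex) auto
  also have "\<dots> = part_int 0 d (part_int d (Suc d) (indicator cyl)) (\<lambda>_. 0)"
    unfolding part_int_def[of 0 d]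
    by (intro Bochner_Integration.integral_cong refl) (subst tri, auto simp: glue_def Rk_def)
  also have "\<dots> = part_int 0 (Suc d) (indicator cyl) (\<lambda>_. 0)"
    by (rule part_int_inner[OF box_fun_cyl, symmetric]) simp
  finally show ?thesis by (simp add: Vol_hull)
qed

end

theorem mainTheorem2:
  fixes d :: nat and P :: "(nat \<Rightarrow> real) set"
  assumes "d \<ge> 1" and "lattice_face d P"
  shows "real (card (Lat d (Omega d P))) = Vol d P"
proof -
  obtain e where e: "d = Suc e" using assms(1) by (cases d) auto
  let ?V = "vertices P"
  have P: "lattice_face (Suc e) P" using assms(2) e by simp
  note V = lattice_face_vertices[OF P]
  have "\<forall>S. aff_basis (Suc e) ?V S \<longrightarrow> (\<exists>f. barycentric (Suc e) f S)"
    using V(1) finite_subset by (auto simp: aff_basis_def intro!: barycentric_exists)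
  then obtain F where F: "\<And>S. aff_basis (Suc e) ?V S \<Longrightarrow> barycentric (Suc e) (F S) S" by metis
  interpret lattice_spanning_set e ?V F
    by unfold_locales (use V F lattice_face_lattice_general[OF P] in auto)
  show ?thesis
    using card_Omega_eq_Vol V(2) e by simp
qed

end
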